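(* Let $n\ge 2$ and $1\leq p\le n-1$. Let $\mathbf{x}=(x_1, \dots, x_p)\in \mathbb{R}^{(n,p)}$ be such that $x_1, \dots, x_p$ are linearly independent and $\mathbf{x}$ is not projectively very well approximable. Then the following property holds: for any $\rho <(n-p)/p$ and any $\mathbf{y}\in\mathbb{R}^{(n,p)}$ with $\mathbf{y}\notin \Gamma \mathbf{x}=\{\gamma\mathbf{x}\mid\gamma\in\Gamma\}$ there exist infinitely many $\gamma \in \Gamma$ such that $$\|\gamma \mathbf{x}-\mathbf{y}\| < \|\gamma\|^{-\rho}.$$ Thus this property holds for Lebesgue almost all $\mathbf{x}\in\mathbb{R}^{(n,p)}$.
   Context: $\mathcal{M}(n,\mathbb{Z})$ is the ring of $n\times n$ matrices with integer entries, and $\Gamma$ is the multiplicative semigroup of all $n\times n$ matrices with integer entries and positive determinant. $\mathbb{R}^{(n,p)}=\mathbb{R}^n\oplus\cdots\oplus\mathbb{R}^n$ ($p$ copies), i.e. $p$-tuples of column vectors in $\mathbb{R}^n$ (equivalently real $n\times p$ matrices). For an $n\times n$ matrix $\xi$ and $\mathbf{x}=(x_1,\dots,x_p)\in\mathbb{R}^{(n,p)}$, $\xi\mathbf{x}=(\xi x_1,\dots,\xi x_p)$. The norm $\|\cdot\|$ of an element of $\mathbb{R}^{(n,p)}$ or of an $n\times n$ matrix is the maximum of the absolute values of its entries. The homogeneous exponent $h(\mathbf{x})$ of $\mathbf{x}\in\mathbb{R}^{(n,p)}$ is the infimum of all real $u$ for which there exists $c>0$ such that $\|\omega\mathbf{x}\|>c\|\omega\|^{-u}$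 for all $\omega\in\mathcal{M}(n,\mathbb{Z})\setminus\{0\}$ (with $h(\mathbf{x})=+\infty$ if there is no such $u$). An element $\mathbf{x}\in\mathbb{R}^{(n,p)}$ is projectively very well approximable if $h(\mathbf{x})>(n-p)/p$. *)

theory Defs
  imports "HOL-Analysis.Analysis"
begin

text \<open>
  Elements of \<open>\<real>\<^sup>(\<^sup>n\<^sup>,\<^sup>p\<^sup>)\<close> have type \<open>(real^'n)^'p\<close>: the component \<open>x $ j\<close> is the \<open>j\<close>-th
  vector \<open>x\<^sub>j\<close> of the tuple, and \<open>x $ j $ i\<close> is the \<open>i\<close>-th coordinate of that vector.
\<close>

text \<open>The maximum norm, both for square matrices and for tuples of vectors; it differs from the
  library's \<^const>\<open>norm\<close> on these types, which is the Euclidean one.\<close>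

definition max_norm :: "real^'a^'b \<Rightarrow> real" where
  "max_norm A = Max {\<bar>A $ i $ j\<bar> | i j. True}"

definition real_mat :: "int^'n^'m \<Rightarrow> real^'n^'m" where
  "real_mat \<omega> = (\<chi> i j. real_of_int (\<omega> $ i $ j))"

definition act :: "int^'n^'n \<Rightarrow> (real^'n)^'p \<Rightarrow> (real^'n)^'p" where
  "act \<xi> x = (\<chi> j. real_mat \<xi> *v (x $ j))"

definition Gamma :: "(int^'n^'n) set" where
  "Gamma = {\<gamma>. det \<gamma> > 0}"

text \<open>The infimum is taken in the extended reals, so it is \<open>\<infinity>\<close> if no \<open>u\<close> is admissible.\<close>

definition homogeneous_exponent :: "(real^'n)^'p \<Rightarrow> ereal" where
  "homogeneous_exponent x =
     Inf (ereal ` {u. \<exists>c>0. \<forall>\<omega>::int^'n^'n. \<omega> \<noteq> 0 \<longrightarrow>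
                     max_norm (act \<omega> x) > c * max_norm (real_mat \<omega>) powr (- u)})"

definition projectively_very_well_approximable :: "(real^'n)^'p \<Rightarrow> bool" where
  "projectively_very_well_approximable x \<longleftrightarrow>
     homogeneous_exponent x > ereal ((real CARD('n) - real CARD('p)) / real CARD('p))"

text \<open>Linear independence of the family \<open>x\<^sub>1, \<dots>, x\<^sub>p\<close>, which excludes repeated vectors.\<close>

definition linearly_independent_tuple :: "(real^'n)^'p \<Rightarrow> bool" where
  "linearly_independent_tuple x \<longleftrightarrow> inj (($) x) \<and> independent (range (($) x))"

definition orbit_approximation_property :: "(real^'n)^'p \<Rightarrow> bool" where
  "orbit_approximation_property x \<longleftrightarrow>
     (\<forall>\<rho>::real. \<rho> < (real CARD('n) - real CARD('p)) / real CARD('p) \<longrightarrow>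
       (\<forall>y::(real^'n)^'p. y \<notin> (\<lambda>\<gamma>. act \<gamma> x) ` Gamma \<longrightarrow>
         infinite {\<gamma> \<in> Gamma. max_norm (act \<gamma> x - y) < max_norm (real_mat \<gamma>) powr (- \<rho>)}))"

end

theory Submission
  imports Defs "HOL-Real_Asymp.Real_Asymp"
begin

text \<open>
  Extend \<open>x\<^sub>1, \<dots>, x\<^sub>p\<close> to a basis of \<open>\<real>\<^sup>n\<close> and, for \<open>T \<ge> 1\<close>, scale the corresponding \<open>n\<close> linear
  forms by \<open>1/\<delta>\<close> (the forms given by the \<open>x\<^sub>k\<close>) and by \<open>1/T\<close> (the others), with \<open>\<delta>\<close> a small multiple
  of \<open>T\<^bsup>-u\<^esup>\<close> and \<open>u\<close> slightly above \<open>(n - p)/p\<close>. The hypothesis on \<open>x\<close> says that the resulting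
  lattice has no non-zero vector of norm below 1, while its covolume is a small power of \<open>T\<close>. A
  packing argument then bounds its covering radius by the same small power of \<open>T\<close>, so every row of
  \<open>y\<close> is approximated by integer vectors of size about \<open>T\<close> with error about \<open>T\<^bsup>-u\<^esup>\<close>. As \<open>p < n\<close>, a
  real matrix \<open>V\<close> with \<open>V x = y\<close> can be chosen singular, which leaves enough freedom to make the
  determinant of the integer matrix positive. Almost every \<open>x\<close> satisfies the hypotheses by the
  convergence part of the Borel--Cantelli argument.
\<close>

subsection \<open>Covering radius of a lattice without short vectors\<close>

definition real_vec :: "int^'n \<Rightarrow> real^'n" where
  "real_vec m = (\<chi> i. real_of_int (m $ i))"

lemma real_vec_nth [simp]: "real_vec m $ i = real_of_int (m $ i)"
  by (simp add: real_vec_def)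

lemma real_vec_add: "real_vec (a + b) = real_vec a + real_vec b"
  by (simp add: vec_eq_iff)

lemma real_vec_diff: "real_vec (a - b) = real_vec a - real_vec b"
  by (simp add: vec_eq_iff)

lemma real_vec_minus: "real_vec (- a) = - real_vec a"
  by (simp add: vec_eq_iff)

lemma real_vec_0 [simp]: "real_vec 0 = 0"
  by (simp add: vec_eq_iff)

lemma infnorm_vec: "infnorm (x::real^'n) = Max (range (\<lambda>i. \<bar>x $ i\<bar>))"
proof -
  have "(\<lambda>b. \<bar>x \<bullet> b\<bar>) ` Basis = range (\<lambda>i. \<bar>x $ i\<bar>)"
    by (force simp: Basis_vec_def inner_axis)
  then show ?thesis by (simp add: infnorm_Max)
qed

lemma infnorm_less_iff: "infnorm (x::real^'n) < c \<longleftrightarrow> (\<forall>i. \<bar>x $ i\<bar> < c)"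
  unfolding infnorm_vec by (subst Max_less_iff) auto

lemma infnorm_le_iff: "infnorm (x::real^'n) \<le> c \<longleftrightarrow> (\<forall>i. \<bar>x $ i\<bar> \<le> c)"
  unfolding infnorm_vec by (subst Max_le_iff) auto

lemma max_norm_set: "{\<bar>A $ i $ j\<bar> | i j. True} = range (\<lambda>(i, j). \<bar>A $ i $ j\<bar>)"
  by auto

lemma max_norm_le_iff: "max_norm A \<le> c \<longleftrightarrow> (\<forall>i j. \<bar>A $ i $ j\<bar> \<le> c)"
  unfolding max_norm_def max_norm_set by (subst Max_le_iff) auto

lemma card_vec_Collect:
  assumes "finite A"
  shows "card {m :: 'a^'n. \<forall>i. m $ i \<in> A} = card A ^ CARD('n)"
    and "finite {m :: 'a^'n. \<forall>i. m $ i \<in> A}"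
proof -
  have eq: "{m :: 'a^'n. \<forall>i. m $ i \<in> A} = vec_lambda ` (PiE UNIV (\<lambda>_. A))"
    by (auto simp: image_iff PiE_def Pi_def) (metis vec_lambda_eta)
  have inj: "inj_on vec_lambda (PiE UNIV (\<lambda>_::'n. A))"
    by (metis inj_onI vec_lambda_inverse UNIV_I)
  show "card {m :: 'a^'n. \<forall>i. m $ i \<in> A} = card A ^ CARD('n)"
    unfolding eq by (simp add: card_image[OF inj] card_PiE)
  show "finite {m :: 'a^'n. \<forall>i. m $ i \<in> A}"
    unfolding eq using assms by (simp add: finite_PiE)
qed

text \<open>Volume comparison for disjoint translates. It serves twice: for unit cubes repeated
  along a lattice, and for shifted copies of a neighbourhood of a resonant subspace. The pointwise
  form of \<open>disj\<close> suits both, as each is checked by subtracting two representations of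
  one point.\<close>

lemma measure_packing:
  fixes S W :: "'a::euclidean_space set"
  assumes "finite I" and S: "S \<in> lmeasurable" and W: "W \<in> lmeasurable"
    and sub: "\<And>i. i \<in> I \<Longrightarrow> (+) (t i) ` S \<subseteq> W"
    and disj: "\<And>i j x y. \<lbrakk>i \<in> I; j \<in> I; x \<in> S; y \<in> S; t i + x = t j + y\<rbrakk> \<Longrightarrow> i = j"
  shows "real (card I) * measure lebesgue S \<le> measure lebesgue W"
proof -
  have "measure lebesgue (\<Union>i\<in>I. (+) (t i) ` S) = (\<Sum>i\<in>I. measure lebesgue ((+) (t i) ` S))"
  proof (rule measure_UNION')
    show "finite I" by fact
    show "(+) (t i) ` S \<in> lmeasurable" if "i \<in> I" for i
      using S by (simp add: measurable_translation)
    show "pairwise (\<lambda>i j. disjnt ((+) (t i) ` S) ((+) (t j) ` S)) I"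
      using disj by (fastforce simp: pairwise_def disjnt_def)
  qed
  also have "\<dots> = real (card I) * measure lebesgue S"
    by (simp add: measure_translation)
  finally have "real (card I) * measure lebesgue S = measure lebesgue (\<Union>i\<in>I. (+) (t i) ` S)" ..
  also have "\<dots> \<le> measure lebesgue W"
    using assms(1) S sub W
    by (intro measure_mono_fmeasurable) (auto intro!: sets.finite_UN fmeasurableD measurable_translation)
  finally show ?thesis .
qed

text \<open>Along the segment from \<open>0\<close> to a badly approximated \<open>\<alpha>\<close> the distance to the lattice takes
  all the values \<open>0, 1, \<dots>, K\<close>; unit cubes centred at the corresponding points and their lattice
  translates are disjoint, so there is no room for them when \<open>K + 1 > \<Delta>\<close>.\<close>

lemma lattice_covering:
  fixes L :: "real^'n^'n" and \<alpha> :: "real^'n"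
  defines "\<Delta> \<equiv> measure lebesgue ((*v) L ` cbox (\<chi> i. - (1/2)) (\<chi> i. 1/2))"
  assumes inv: "invertible L"
    and min: "\<And>m::int^'n. m \<noteq> 0 \<Longrightarrow> infnorm (L *v real_vec m) \<ge> 1"
  shows "\<exists>m::int^'n. infnorm (L *v real_vec m - \<alpha>) < \<Delta>"
proof (rule ccontr)
  assume contra: "\<nexists>m::int^'n. infnorm (L *v real_vec m - \<alpha>) < \<Delta>"
  \<comment> \<open>This is the sup-norm distance from \<open>v\<close> to the lattice.\<close>
  define f where "f v = (INF m::int^'n. infnorm (L *v real_vec m - v))" for v
  have bdd: "bdd_below (range (\<lambda>m::int^'n. infnorm (L *v real_vec m - v)))" for v
    by (rule bdd_belowI[of _ 0]) (auto simp: infnorm_pos_le)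
  \<comment> \<open>The free lattice vector \<open>m\<close> gives two uses: \<open>m = 0\<close>
    yields that \<open>f\<close> is 1-Lipschitz, and arbitrary \<open>m\<close> separates level sets
    of \<open>f\<close> modulo the lattice.\<close>
  have f_le: "f p \<le> f q + infnorm (p - q - L *v real_vec m)" for p q m
  proof -
    have "f p - infnorm (p - q - L *v real_vec m) \<le> infnorm (L *v real_vec m' - q)" for m'
    proof -
      have "f p \<le> infnorm (L *v real_vec (m + m') - p)"
        unfolding f_def by (rule cINF_lower[OF bdd]) auto
      also have "L *v real_vec (m + m') - p = (L *v real_vec m' - q) + - (p - q - L *v real_vec m)"
        by (simp add: real_vec_add matrix_vector_right_distrib)
      also have "infnorm \<dots> \<le> infnorm (L *v real_vec m' - q) + infnorm (p - q - L *v real_vec m)"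
        by (metis infnorm_neg infnorm_triangle)
      finally show ?thesis by simp
    qed
    then have "f p - infnorm (p - q - L *v real_vec m) \<le> f q"
      unfolding f_def[of q] by (intro cINF_greatest) auto
    then show ?thesis by simp
  qed
  have f_diff: "\<bar>f p - f q\<bar> \<le> infnorm (p - q)" for p q
    using f_le[of p q 0] f_le[of q p 0] by (simp add: infnorm_sub[of q p])
  have f_nonneg: "f v \<ge> 0" for v
    unfolding f_def by (intro cINF_greatest) (auto simp: infnorm_pos_le)
  have "f 0 \<le> infnorm (L *v real_vec 0 - 0)"
    unfolding f_def by (rule cINF_lower[OF bdd]) auto
  then have f_0: "f 0 = 0"
    using f_nonneg[of 0] by (simp add: infnorm_0)
  have f_\<alpha>: "f \<alpha> \<ge> \<Delta>"
    unfolding f_def using contra by (intro cINF_greatest) (auto simp: not_less)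
  have cont: "continuous_on {0..1} (\<lambda>t. f (t *\<^sub>R \<alpha>))"
    unfolding continuous_on_iff
  proof (intro ballI allI impI)
    fix t e :: real assume "e > 0"
    have "\<bar>f (s *\<^sub>R \<alpha>) - f (t *\<^sub>R \<alpha>)\<bar> < e" if "\<bar>s - t\<bar> < e / (infnorm \<alpha> + 1)" for s
    proof -
      have pos: "infnorm \<alpha> + 1 > 0" using infnorm_pos_le[of \<alpha>] by simp
      have "\<bar>f (s *\<^sub>R \<alpha>) - f (t *\<^sub>R \<alpha>)\<bar> \<le> \<bar>s - t\<bar> * infnorm \<alpha>"
        using f_diff[of "s *\<^sub>R \<alpha>" "t *\<^sub>R \<alpha>"] by (simp add: infnorm_mul flip: scaleR_left_diff_distrib)
      also have "\<dots> \<le> \<bar>s - t\<bar> * (infnorm \<alpha> + 1)"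
        by (simp add: mult_left_mono)
      also have "\<dots> < e" using that pos by (simp add: pos_less_divide_eq)
      finally show ?thesis .
    qed
    then show "\<exists>d>0. \<forall>s\<in>{0..1}. dist s t < d \<longrightarrow> dist (f (s *\<^sub>R \<alpha>)) (f (t *\<^sub>R \<alpha>)) < e"
      using \<open>e > 0\<close> infnorm_pos_le[of \<alpha>]
      by (intro exI[of _ "e / (infnorm \<alpha> + 1)"]) (auto simp: dist_real_def)
  qed
  \<comment> \<open>The levels 0 to \<open>K\<close> give \<open>K + 1\<close> points, and
    \<open>K + 1\<close> exceeds \<Delta> because \<open>f \<alpha> \<ge> \<Delta>\<close>.\<close>
  define K where "K = nat \<lfloor>f \<alpha>\<rfloor>"
  have K: "real K \<le> f \<alpha>" "real K + 1 > \<Delta>"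
    unfolding K_def using f_nonneg[of \<alpha>] f_\<alpha> by linarith+
  have "\<exists>t. f (t *\<^sub>R \<alpha>) = real k" if "k \<le> K" for k
  proof -
    have "\<exists>t\<ge>0. t \<le> 1 \<and> f (t *\<^sub>R \<alpha>) = real k"
      using that K(1) cont by (intro IVT') (auto simp: f_0)
    then show ?thesis by blast
  qed
  then obtain t where t: "\<And>k. k \<le> K \<Longrightarrow> f (t k *\<^sub>R \<alpha>) = real k" by metis
  define p where "p k = t k *\<^sub>R \<alpha>" for k
  have sep: "infnorm (p j - p k - L *v real_vec m) \<ge> 1"
    if "j \<le> K" "k \<le> K" "j \<noteq> k" for j k m
  proof -
    have *: "infnorm (p j - p k - L *v real_vec m) \<ge> 1" if "j \<le> K" "k \<le> K" "k < j" for j k m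
      using f_le[of "p j" "p k" m] t[OF that(1)] t[OF that(2)] that(3) by (simp add: p_def)
    have "p j - p k - L *v real_vec m = - (p k - p j - L *v real_vec (- m))"
      by (simp add: real_vec_minus linear_neg[OF matrix_vector_mul_linear])
    then have "infnorm (p j - p k - L *v real_vec m) = infnorm (p k - p j - L *v real_vec (- m))"
      by (metis infnorm_neg)
    then show ?thesis
      using *[of j k m] *[of k j "- m"] that by (cases j k rule: linorder_cases) auto
  qed
  \<comment> \<open>The cube is open, so two of its points differ by less than 1 in sup norm; this
    contradicts separation by at least 1.\<close>
  define Q :: "(real^'n) set" where "Q = box (\<chi> i. - (1/2)) (\<chi> i. 1/2)"
  have Q_iff: "v \<in> Q \<longleftrightarrow> (\<forall>i. \<bar>v $ i\<bar> < 1/2)" for v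
  proof -
    have "(- (1/2) < a \<and> a < 1/2) = (\<bar>a\<bar> < 1/2)" for a :: real by auto
    then show ?thesis by (simp only: Q_def mem_box_cart vec_lambda_beta)
  qed
  have content_cube: "measure lebesgue (cbox (\<chi> i. - c) (\<chi> i. c) :: (real^'n) set) = (2*c) ^ CARD('n)"
    if "c \<ge> 0" for c
  proof -
    have "cbox (\<chi> i. - c) (\<chi> i. c) \<noteq> ({} :: (real^'n) set)"
      using that by (auto simp: interval_eq_empty_cart)
    then show ?thesis by (simp add: content_cbox_cart)
  qed
  have Q_meas: "Q \<in> lmeasurable" and Q1: "measure lebesgue Q = 1"
    using content_cube[of "1/2"] by (auto simp: Q_def measure_lborel_box_eq measure_lborel_cbox_eq)
  obtain L' where L': "L ** L' = mat 1" "L' ** L = mat 1"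
    using inv by (metis invertible_def)
  have "bounded (\<Union>k\<le>K. (\<lambda>v. L' *v (p k + v)) ` Q)"
  proof (intro bounded_UN finite_atMost ballI)
    fix k
    have "bounded ((*v) L' ` ((+) (p k) ` Q))"
      by (intro bounded_linear_image bounded_translation)
        (auto simp: Q_def matrix_vector_mul_bounded_linear)
    then show "bounded ((\<lambda>v. L' *v (p k + v)) ` Q)"
      by (simp add: image_image)
  qed
  then obtain C0 where C0: "\<And>k v. k \<le> K \<Longrightarrow> v \<in> Q \<Longrightarrow> norm (L' *v (p k + v)) \<le> C0"
    unfolding bounded_iff by auto
  define C where "C = max C0 0"
  have C: "\<bar>(L' *v (p k + v)) $ i\<bar> \<le> C" if "k \<le> K" "v \<in> Q" for k v i
    using C0[OF that] component_le_norm_cart[of "L' *v (p k + v)" i] by (simp add: C_def)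
  \<comment> \<open>The left side counts unit cubes indexed by \<open>K + 1\<close> points and the
    integer vectors of norm at most \<open>R\<close>. Since \<open>C\<close> bounds the preimages
    under \<open>L\<close> of the cubes at the \<open>p k\<close>, they all lie in the image of a
    cube of side \<open>2 * (R + C)\<close>.\<close>
  have count: "(real K + 1) * (2 * real R + 1) ^ CARD('n) \<le> \<Delta> * (2 * (real R + C)) ^ CARD('n)"
    for R :: nat
  proof -
    define M where "M = {m::int^'n. \<forall>i. m $ i \<in> {- int R..int R}}"
    define W where "W = (*v) L ` cbox (\<chi> i. - (real R + C)) (\<chi> i. real R + C)"
    have "real (card ({..K} \<times> M)) * measure lebesgue Q \<le> measure lebesgue W"
    proof (rule measure_packing[where t = "\<lambda>(k, m). p k + L *v real_vec m"])
      show "finite ({..K} \<times> M)"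
        unfolding M_def by (intro finite_cartesian_product card_vec_Collect) auto
      show "W \<in> lmeasurable"
        by (simp add: W_def measurable_linear_image_interval)
      show "Q \<in> lmeasurable" by fact
    next
      fix km assume "km \<in> {..K} \<times> M"
      then obtain k m where km: "km = (k, m)" "k \<le> K" "m \<in> M" by auto
      have "p k + L *v real_vec m + v \<in> W" if "v \<in> Q" for v
      proof -
        have "p k + L *v real_vec m + v = L *v (real_vec m + L' *v (p k + v))"
          by (simp add: matrix_vector_right_distrib matrix_vector_mul_assoc L')
        moreover have "real_vec m + L' *v (p k + v) \<in> cbox (\<chi> i. - (real R + C)) (\<chi> i. real R + C)"
        proof -
          have "\<bar>(real_vec m + L' *v (p k + v)) $ i\<bar> \<le> real R + C" for i
          proof -
            have "\<bar>real_of_int (m $ i)\<bar> \<le> real R"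
              using km(3) by (auto simp: M_def abs_le_iff) (metis atLeastAtMost_iff of_int_le_iff of_int_minus of_int_of_nat_eq minus_le_iff)+
            then show ?thesis using C[OF km(2) that, of i] by simp
          qed
          then show ?thesis unfolding mem_box_cart abs_le_iff vec_lambda_beta by (metis minus_le_iff)
        qed
        ultimately show ?thesis unfolding W_def by blast
      qed
      then show "(+) (case km of (k, m) \<Rightarrow> p k + L *v real_vec m) ` Q \<subseteq> W"
        by (auto simp: km)
    next
      fix a b v w
      assume ab: "a \<in> {..K} \<times> M" "b \<in> {..K} \<times> M" and vw: "v \<in> Q" "w \<in> Q"
        and eq: "(case a of (k, m) \<Rightarrow> p k + L *v real_vec m) + v = (case b of (k, m) \<Rightarrow> p k + L *v real_vec m) + w"
      obtain j m k m' where a: "a = (j, m)" "b = (k, m')" by fastforce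
      have jk: "j \<le> K" "k \<le> K" using ab a by auto
      have "p j - p k - L *v real_vec (m' - m) = w - v"
        using eq a by (simp add: real_vec_diff matrix_vector_mult_diff_distrib algebra_simps)
      moreover have "infnorm (w - v) < 1"
        unfolding infnorm_less_iff using vw[unfolded Q_iff]
        by (metis abs_triangle_ineq4 add_strict_mono field_sum_of_halves le_less_trans vector_minus_component)
      ultimately have small: "infnorm (p j - p k - L *v real_vec (m' - m)) < 1" by simp
      \<comment> \<open>Overlap of cubes with different indices contradicts \<open>sep\<close>; with
        equal indices it would produce a non-zero lattice vector of norm below 1.\<close>
      then have "j = k" using sep[OF jk, of "m' - m"] by fastforce
      moreover have "m' - m = 0"
      proof (rule ccontr)
        assume "m' - m \<noteq> 0"
        from min[OF this] small \<open>j = k\<close> show False by (simp add: infnorm_neg)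
      qed
      ultimately show "a = b" by (simp add: a)
    qed
    moreover have "card M = (2 * R + 1) ^ CARD('n)"
      unfolding M_def by (subst card_vec_Collect) (auto simp: nat_add_distrib nat_mult_distrib)
    moreover have "measure lebesgue W = \<Delta> * (2 * (real R + C)) ^ CARD('n)"
    proof -
      define c where "c = 2 * (real R + C)"
      have "c \<ge> 0" by (simp add: c_def C_def)
      have "cbox (\<chi> i. - (real R + C)) (\<chi> i. real R + C) = (\<lambda>x::real^'n. \<chi> k. c * x $ k) ` cbox (\<chi> i. - (1/2)) (\<chi> i. 1/2)"
      proof -
        have "real R + C = c * (1/2)" "- (real R + C) = c * - (1/2)"
          by (simp_all add: c_def field_simps)
        then show ?thesis
          using \<open>c \<ge> 0\<close>
          by (simp only:) (simp add: image_stretch_interval_cart interval_eq_empty_cart min_def max_def)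
      qed
      then have "W = (\<lambda>x. \<chi> k. c * x $ k) ` (*v) L ` cbox (\<chi> i. - (1/2)) (\<chi> i. 1/2)"
        unfolding W_def by (simp add: image_image matrix_vector_mult_def sum_distrib_left mult_ac)
      then show ?thesis
        using \<open>c \<ge> 0\<close> measure_stretch[of "(*v) L ` cbox (\<chi> i. - (1/2)) (\<chi> i. 1/2)" "\<lambda>_. c"]
        by (simp add: measurable_linear_image_interval \<Delta>_def power_abs c_def mult.commute)
    qed
    ultimately show ?thesis by (simp add: Q1 card_cartesian_product algebra_simps)
  qed
  \<comment> \<open>As \<open>R\<close> grows, the boundary effect due to \<open>C\<close>
    disappears after division by the number of integer vectors.\<close>
  have "(\<lambda>R::nat. (2 * (real R + C)) / (2 * real R + 1)) \<longlonglongrightarrow> 1"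
    by real_asymp
  then have "(\<lambda>R::nat. \<Delta> * ((2 * (real R + C)) / (2 * real R + 1)) ^ CARD('n)) \<longlonglongrightarrow> \<Delta> * 1 ^ CARD('n)"
    by (intro tendsto_intros)
  moreover have "real K + 1 \<le> \<Delta> * ((2 * (real R + C)) / (2 * real R + 1)) ^ CARD('n)" for R :: nat
    using count[of R] by (simp add: power_divide pos_le_divide_eq)
  ultimately have "real K + 1 \<le> \<Delta>"
    by (intro LIMSEQ_le_const) auto
  with K(2) show False by simp
qed

subsection \<open>Integer matrices of positive determinant\<close>

lemma linear_eq_sum_axis:
  fixes \<phi> :: "real^'n \<Rightarrow> real"
  assumes "linear \<phi>"
  shows "\<phi> z = (\<Sum>k\<in>UNIV. z $ k * \<phi> (axis k 1))"
proof -
  have "\<phi> z = \<phi> (\<Sum>k\<in>UNIV. z $ k *\<^sub>R axis k 1)"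
    using basis_expansion[of z] by (simp add: scalar_mult_eq_scaleR)
  then show ?thesis
    using assms by (simp add: linear_sum linear_scale)
qed

text \<open>Here \<open>S\<close> is the dual norm of \<phi> for the norm
  \<open>infnorm (L *v v)\<close>, that is, the sum of the absolute values of the coefficients of
  \<phi> in the coordinates \<open>L *v v\<close>. Moving the target by \<open>s\<close> times an
  extremal vector costs at most \<open>s\<close> in norm and gains \<open>s * S\<close>; passing to
  a lattice point loses less than \<open>D * S\<close>.\<close>

lemma lattice_point_pushed_along_functional:
  fixes L :: "real^'n^'n" and \<phi> :: "real^'n \<Rightarrow> real"
  assumes inv: "invertible L"
    and cover: "\<And>v. \<exists>m::int^'n. infnorm (L *v (real_vec m - v)) < D"
    and lin: "linear \<phi>" and nz: "\<phi> u \<noteq> 0"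
  obtains S where "S > 0" and "\<And>v. \<bar>\<phi> v\<bar> \<le> S * infnorm (L *v v)"
    and "\<And>v s. s \<ge> 0 \<Longrightarrow> \<exists>m::int^'n. infnorm (L *v (real_vec m - v)) < D + s \<and>
           \<phi> (real_vec m) > \<phi> v + (s - D) * S"
proof -
  obtain L' where L': "L ** L' = mat 1" "L' ** L = mat 1"
    using inv by (metis invertible_def)
  define \<psi> where "\<psi> z = \<phi> (L' *v z)" for z
  have lin': "linear \<psi>"
    unfolding \<psi>_def using lin linear_compose[OF matrix_vector_mul_linear[of L'] lin] by (simp add: o_def)
  define S where "S = (\<Sum>k\<in>UNIV. \<bar>\<psi> (axis k 1)\<bar>)"
  have \<phi>_eq: "\<phi> v = \<psi> (L *v v)" for v
    by (simp add: \<psi>_def matrix_vector_mul_assoc L')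
  have bound: "\<bar>\<phi> v\<bar> \<le> S * infnorm (L *v v)" for v
  proof -
    have "\<bar>\<psi> z\<bar> \<le> (\<Sum>k\<in>UNIV. \<bar>z $ k * \<psi> (axis k 1)\<bar>)" for z
      using linear_eq_sum_axis[OF lin', of z] by simp
    also have "(\<Sum>k\<in>UNIV. \<bar>z $ k * \<psi> (axis k 1)\<bar>) \<le> (\<Sum>k\<in>UNIV. infnorm z * \<bar>\<psi> (axis k 1)\<bar>)" for z
      by (intro sum_mono) (simp add: abs_mult mult_right_mono component_le_infnorm_cart)
    finally show ?thesis
      by (simp add: \<phi>_eq S_def mult.commute flip: sum_distrib_left)
  qed
  have "S \<ge> 0" by (simp add: S_def sum_nonneg)
  moreover have "S \<noteq> 0" using bound[of u] nz by auto
  ultimately have "S > 0" by simp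
  \<comment> \<open>The sign vector of the coefficients has norm at most 1, and \<phi> attains
    \<open>S\<close> on its preimage.\<close>
  define w where "w = L' *v (\<chi> k. sgn (\<psi> (axis k 1)))"
  have Lw: "L *v w = (\<chi> k. sgn (\<psi> (axis k 1)))"
    by (simp add: w_def matrix_vector_mul_assoc L')
  have inf_w: "infnorm (L *v w) \<le> 1"
    unfolding Lw infnorm_le_iff by (simp add: abs_sgn_eq)
  have \<phi>w: "\<phi> w = S"
    unfolding \<phi>_eq Lw linear_eq_sum_axis[OF lin', of "vec_lambda _"] S_def
    by (simp add: abs_sgn mult.commute)
  have push: "\<exists>m::int^'n. infnorm (L *v (real_vec m - v)) < D + s \<and> \<phi> (real_vec m) > \<phi> v + (s - D) * S"
    if "s \<ge> 0" for v s
  proof -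
    obtain m :: "int^'n" where m: "infnorm (L *v (real_vec m - (v + s *\<^sub>R w))) < D"
      using cover by blast
    define e where "e = real_vec m - (v + s *\<^sub>R w)"
    have m_eq: "real_vec m = v + s *\<^sub>R w + e" by (simp add: e_def)
    have "infnorm (L *v (real_vec m - v)) = infnorm (L *v e + s *\<^sub>R (L *v w))"
      by (simp add: m_eq matrix_vector_right_distrib matrix_vector_mult_scaleR add.commute)
    also have "\<dots> \<le> infnorm (L *v e) + s * infnorm (L *v w)"
      using infnorm_triangle[of "L *v e" "s *\<^sub>R (L *v w)"] that by (simp add: infnorm_mul)
    also have "\<dots> < D + s"
      using m that mult_left_mono[OF inf_w, of s] by (simp add: e_def)
    finally have 1: "infnorm (L *v (real_vec m - v)) < D + s" .
    have "\<bar>\<phi> e\<bar> \<le> S * infnorm (L *v e)" by (rule bound)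
    also have "\<dots> < S * D" using m \<open>S > 0\<close> by (simp add: e_def)
    finally have "\<phi> e > - (S * D)" by linarith
    moreover have "\<phi> (real_vec m) = \<phi> v + s * S + \<phi> e"
      using lin by (simp add: m_eq linear_add linear_scale \<phi>w)
    ultimately have 2: "\<phi> (real_vec m) > \<phi> v + (s - D) * S" by (simp add: algebra_simps)
    from 1 2 show ?thesis by blast
  qed
  show ?thesis by (rule that[OF \<open>S > 0\<close> bound push])
qed

lemma linear_det_row:
  fixes M :: "real^'n^'n"
  shows "linear (\<lambda>v. det (\<chi> k. if k = i then v else M $ k))"
proof
  show "det (\<chi> k. if k = i then v + w else M $ k) =
      det (\<chi> k. if k = i then v else M $ k) + det (\<chi> k. if k = i then w else M $ k)" for v w
    using det_row_add[of i "\<lambda>_. v" "\<lambda>_. w" "\<lambda>k. M $ k"] by simp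
  show "det (\<chi> k. if k = i then c *\<^sub>R v else M $ k) =
      c *\<^sub>R det (\<chi> k. if k = i then v else M $ k)" for c v
    using det_row_mul[of i c "\<lambda>_. v" "\<lambda>k. M $ k"] unfolding scalar_mult_eq_scaleR by simp
qed

lemma linear_relation_solved:
  fixes v :: "'k::finite \<Rightarrow> 'a::real_vector"
  assumes "(\<Sum>k\<in>UNIV. b k *\<^sub>R v k) = 0" "b i \<noteq> 0"
  shows "v i = (\<Sum>k\<in>UNIV - {i}. (- inverse (b i) * b k) *\<^sub>R v k)"
proof -
  have "b i *\<^sub>R v i = - (\<Sum>k\<in>UNIV - {i}. b k *\<^sub>R v k)"
    using assms(1) by (simp add: sum.remove[of _ i] add_eq_0_iff2)
  then have "(inverse (b i) * b i) *\<^sub>R v i = (\<Sum>k\<in>UNIV - {i}. (- inverse (b i) * b k) *\<^sub>R v k)"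
    by (simp add: scaleR_sum_right sum_negf flip: scaleR_scaleR)
  then show ?thesis using assms(2) by simp
qed

lemma row_combination_if_det_0:
  fixes V :: "real^'n^'n"
  assumes "det V = 0"
  obtains i c where "V $ i = (\<Sum>k\<in>UNIV - {i}. c k *\<^sub>R V $ k)"
proof -
  have "\<not> (\<exists>B. V ** B = mat 1)"
    using assms by (metis invertible_det_nz invertible_right_inverse)
  then obtain b i where b: "(\<Sum>k\<in>UNIV. b k *s row k V) = 0" "b i \<noteq> 0"
    unfolding matrix_right_invertible_independent_rows by blast
  have row: "row k V = V $ k" for k by (simp add: row_def vec_eq_iff)
  have "V $ i = (\<Sum>k\<in>UNIV - {i}. (- inverse (b i) * b k) *\<^sub>R V $ k)"
    using b by (intro linear_relation_solved) (auto simp: row scalar_mult_eq_scaleR)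
  then show ?thesis by (rule that)
qed

lemma det_real_mat: "det (real_mat \<gamma>) = real_of_int (det \<gamma>)"
  by (simp add: det_def real_mat_def)

text \<open>All rows but one are replaced by nearby integer vectors, keeping the determinant non-zero.
  The remaining row of \<open>V\<close> is a combination of the others, so it almost lies in the hyperplane
  spanned by the integer rows, and a short push to the correct side gives a positive determinant.\<close>

lemma integer_matrix_near_singular:
  fixes V :: "real^'n^'n"
  assumes "det V = 0"
  obtains \<kappa> where "\<kappa> > 0"
    and "\<And>(L::real^'n^'n) D. \<lbrakk>invertible L; \<And>v. \<exists>m::int^'n. infnorm (L *v (real_vec m - v)) < D\<rbrakk> \<Longrightarrow>
           \<exists>\<gamma>::int^'n^'n. det \<gamma> > 0 \<and> (\<forall>i. infnorm (L *v (real_vec (\<gamma> $ i) - V $ i)) < \<kappa> * D)"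
proof -
  obtain i0 c where V_i0: "V $ i0 = (\<Sum>k\<in>UNIV - {i0}. c k *\<^sub>R V $ k)"
    using row_combination_if_det_0[OF assms] .
  define C where "C = (\<Sum>k\<in>UNIV - {i0}. \<bar>c k\<bar>)"
  have "C \<ge> 0" by (simp add: C_def sum_nonneg)
  have main: "\<exists>\<gamma>::int^'n^'n. det \<gamma> > 0 \<and> (\<forall>i. infnorm (L *v (real_vec (\<gamma> $ i) - V $ i)) < (2 + 2 * C) * D)"
    if inv: "invertible L" and cover: "\<And>v. \<exists>m::int^'n. infnorm (L *v (real_vec m - v)) < D"
    for L :: "real^'n^'n" and D
  proof -
    have "D > 0" using cover[of 0] infnorm_pos_le by (meson le_less_trans)
    have step: "\<exists>m::int^'n. infnorm (L *v (real_vec m - v)) < 2 * D \<and>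
        det (\<chi> k. if k = i then real_vec m else M $ k) \<noteq> 0"
      if "det M \<noteq> 0" for M :: "real^'n^'n" and i v
    proof -
      define \<phi> where "\<phi> v = det (\<chi> k. if k = i then v else M $ k)" for v
      have lin: "linear \<phi>" unfolding \<phi>_def by (rule linear_det_row)
      have "(\<chi> k. if k = i then M $ i else M $ k) = M" by (simp add: vec_eq_iff)
      then have nz: "\<phi> (M $ i) \<noteq> 0" using that by (simp add: \<phi>_def)
      \<comment> \<open>The target is pushed to the side on which \<phi> already lies. A push of
        length \<open>D\<close> exactly compensates the covering error, and the strict inequality
        keeps the determinant non-zero.\<close>
      define \<sigma> :: real where "\<sigma> = (if \<phi> v \<ge> 0 then 1 else - 1)"
      have lin\<sigma>: "linear (\<lambda>v. \<sigma> * \<phi> v)"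
        using linear_compose_scale_right[OF lin, of \<sigma>] by simp
      have nz\<sigma>: "\<sigma> * \<phi> (M $ i) \<noteq> 0" using nz by (simp add: \<sigma>_def)
      obtain S where "\<And>v s. s \<ge> 0 \<Longrightarrow> \<exists>m::int^'n. infnorm (L *v (real_vec m - v)) < D + s \<and>
           \<sigma> * \<phi> (real_vec m) > \<sigma> * \<phi> v + (s - D) * S"
        by (rule lattice_point_pushed_along_functional[OF inv cover lin\<sigma> nz\<sigma>]) blast
      from this[of D v] \<open>D > 0\<close> obtain m where m: "infnorm (L *v (real_vec m - v)) < D + D"
        "\<sigma> * \<phi> (real_vec m) > \<sigma> * \<phi> v" by auto
      have "\<sigma> * \<phi> v \<ge> 0" by (simp add: \<sigma>_def)
      then have "\<phi> (real_vec m) \<noteq> 0" using m(2) by auto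
      then show ?thesis using m(1) by (auto simp: \<phi>_def)
    qed
    have "\<exists>M::real^'n^'n. det M \<noteq> 0 \<and>
        (\<forall>i\<in>A. \<exists>m::int^'n. M $ i = real_vec m \<and> infnorm (L *v (M $ i - V $ i)) < 2 * D)"
      if "finite A" for A
      using that
    proof induction
      case empty
      \<comment> \<open>Any non-singular matrix can start the induction; its rows are replaced one
        at a time by integer vectors near the rows of \<open>V\<close>.\<close>
      show ?case by (intro exI[of _ "mat 1"]) simp
    next
      case (insert i A)
      then obtain M :: "real^'n^'n" where M: "det M \<noteq> 0"
        "\<forall>i\<in>A. \<exists>m::int^'n. M $ i = real_vec m \<and> infnorm (L *v (M $ i - V $ i)) < 2 * D" by blast
      obtain m :: "int^'n" where m: "infnorm (L *v (real_vec m - V $ i)) < 2 * D"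
        "det (\<chi> k. if k = i then real_vec m else M $ k) \<noteq> 0"
        using step[OF M(1)] by blast
      show ?case
        using M(2) m by (intro exI[of _ "\<chi> k. if k = i then real_vec m else M $ k"]) auto
    qed
    from this[of "UNIV - {i0}"] obtain M :: "real^'n^'n" where M: "det M \<noteq> 0"
      "\<And>i. i \<noteq> i0 \<Longrightarrow> \<exists>m::int^'n. M $ i = real_vec m \<and> infnorm (L *v (M $ i - V $ i)) < 2 * D"
      by auto
    from M(2) obtain g :: "'n \<Rightarrow> int^'n" where g: "\<And>i. i \<noteq> i0 \<Longrightarrow> M $ i = real_vec (g i)"
      "\<And>i. i \<noteq> i0 \<Longrightarrow> infnorm (L *v (M $ i - V $ i)) < 2 * D" by metis
    define \<phi> where "\<phi> v = det (\<chi> k. if k = i0 then v else M $ k)" for v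
    have lin: "linear \<phi>" unfolding \<phi>_def by (rule linear_det_row)
    have "(\<chi> k. if k = i0 then M $ i0 else M $ k) = M" by (simp add: vec_eq_iff)
    then have nz: "\<phi> (M $ i0) \<noteq> 0" using M(1) by (simp add: \<phi>_def)
    \<comment> \<open>The functional vanishes on the other rows, so in the expansion of
      \<open>V $ i0\<close> each \<open>V $ k\<close> may be replaced by
      \<open>V $ k - M $ k\<close>, which is small.\<close>
    have \<phi>_0: "\<phi> (M $ k) = 0" if "k \<noteq> i0" for k
      unfolding \<phi>_def using that by (intro det_identical_rows[of i0 k]) (auto simp: row_def)
    obtain S where S: "S > 0" "\<And>v. \<bar>\<phi> v\<bar> \<le> S * infnorm (L *v v)"
      "\<And>v s. s \<ge> 0 \<Longrightarrow> \<exists>m::int^'n. infnorm (L *v (real_vec m - v)) < D + s \<and>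
           \<phi> (real_vec m) > \<phi> v + (s - D) * S"
      using lattice_point_pushed_along_functional[OF inv cover lin nz] by blast
    have "\<bar>\<phi> (V $ i0)\<bar> \<le> 2 * C * D * S"
    proof -
      have "\<phi> (V $ i0) = (\<Sum>k\<in>UNIV - {i0}. c k * - \<phi> (M $ k - V $ k))"
        using lin by (simp add: V_i0 linear_sum linear_scale linear_diff \<phi>_0)
      also have "\<bar>\<dots>\<bar> \<le> (\<Sum>k\<in>UNIV - {i0}. \<bar>c k * - \<phi> (M $ k - V $ k)\<bar>)" by (rule sum_abs)
      also have "\<dots> \<le> (\<Sum>k\<in>UNIV - {i0}. \<bar>c k\<bar> * (S * (2 * D)))"
      proof (rule sum_mono)
        fix k assume "k \<in> UNIV - {i0}"
        then have "infnorm (L *v (M $ k - V $ k)) \<le> 2 * D" using g(2)[of k] by simp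
        then have "\<bar>\<phi> (M $ k - V $ k)\<bar> \<le> S * (2 * D)"
          using S(1) S(2)[of "M $ k - V $ k"] by (meson mult_left_mono order_trans less_imp_le)
        then show "\<bar>c k * - \<phi> (M $ k - V $ k)\<bar> \<le> \<bar>c k\<bar> * (S * (2 * D))"
          by (simp add: abs_mult mult_left_mono)
      qed
      also have "\<dots> = 2 * C * D * S" by (simp add: C_def mult_ac sum_distrib_left sum_distrib_right)
      finally show ?thesis .
    qed
    \<comment> \<open>With \<open>s = (1 + 2 * C) * D\<close> the gain \<open>(s - D) * S\<close>
      equals the bound \<open>2 * C * D * S\<close> for \<open>\<phi> (V $ i0)\<close>, and the
      total distance \<open>D + s\<close> gives the constant \<open>2 + 2 * C\<close>.\<close>
    moreover obtain m :: "int^'n" where m: "infnorm (L *v (real_vec m - V $ i0)) < D + (1 + 2 * C) * D"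
      "\<phi> (real_vec m) > \<phi> (V $ i0) + ((1 + 2 * C) * D - D) * S"
      using S(3)[of "(1 + 2 * C) * D" "V $ i0"] \<open>C \<ge> 0\<close> \<open>D > 0\<close> by auto
    ultimately have pos: "\<phi> (real_vec m) > 0"
      by (simp add: algebra_simps)
    define \<gamma> where "\<gamma> = (\<chi> k. if k = i0 then m else g k)"
    have "real_mat \<gamma> = (\<chi> k. if k = i0 then real_vec m else M $ k)"
      by (simp add: \<gamma>_def real_mat_def vec_eq_iff g(1))
    then have "real_of_int (det \<gamma>) > 0" using pos by (simp add: \<phi>_def flip: det_real_mat)
    then have "det \<gamma> > 0" by simp
    moreover have "infnorm (L *v (real_vec (\<gamma> $ i) - V $ i)) < (2 + 2 * C) * D" for i
    proof (cases "i = i0")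
      case True
      then show ?thesis using m(1) by (simp add: \<gamma>_def algebra_simps)
    next
      case False
      have "2 * D \<le> (2 + 2 * C) * D" using \<open>C \<ge> 0\<close> \<open>D > 0\<close> by (simp add: algebra_simps)
      then show ?thesis using False g[OF False] by (simp add: \<gamma>_def)
    qed
    ultimately show ?thesis by blast
  qed
  show ?thesis
    using \<open>C \<ge> 0\<close> by (intro that[of "2 + 2 * C"] main) auto
qed

subsection \<open>Approximation by the orbit\<close>

lemma act_nth: "act \<gamma> x $ k $ i = real_vec (\<gamma> $ i) \<bullet> x $ k"
  by (simp add: act_def real_mat_def matrix_vector_mult_def inner_vec_def)

lemma max_norm_attained:
  obtains i j where "max_norm A = \<bar>A $ i $ j\<bar>"
proof -
  have "max_norm A \<in> range (\<lambda>(i, j). \<bar>A $ i $ j\<bar>)"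
    unfolding max_norm_def max_norm_set by (intro Max_in) auto
  then show ?thesis using that by auto
qed

lemma nth_le_max_norm: "\<bar>A $ i $ j\<bar> \<le> max_norm A"
  using max_norm_le_iff[of A "max_norm A"] by simp

lemma infnorm_row_le_max_norm: "infnorm (real_vec (\<omega> $ i)) \<le> max_norm (real_mat \<omega>)"
  unfolding infnorm_le_iff using nth_le_max_norm[of "real_mat \<omega>" i] by (simp add: real_mat_def)

lemma max_norm_row_attained:
  obtains i where "max_norm (real_mat \<omega>) = infnorm (real_vec (\<omega> $ i))"
proof -
  obtain i j where ij: "max_norm (real_mat \<omega>) = \<bar>real_mat \<omega> $ i $ j\<bar>"
    by (rule max_norm_attained)
  have "\<bar>real_mat \<omega> $ i $ j\<bar> \<le> infnorm (real_vec (\<omega> $ i))"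
    using component_le_infnorm_cart[of "real_vec (\<omega> $ i)" j] by (simp add: real_mat_def)
  then show ?thesis
    using that[of i] ij infnorm_row_le_max_norm[of \<omega> i] by linarith
qed

lemma infnorm_real_vec_ge_1:
  assumes "m \<noteq> 0"
  shows "infnorm (real_vec m) \<ge> 1"
proof -
  obtain i where "m $ i \<noteq> 0" using assms by (auto simp: vec_eq_iff)
  then have "1 \<le> \<bar>m $ i\<bar>" by linarith
  then have "1 \<le> \<bar>real_vec m $ i\<bar>"
    unfolding real_vec_nth of_int_abs[symmetric] by (simp only: of_int_1_le_iff)
  then show ?thesis using component_le_infnorm_cart[of "real_vec m" i] by linarith
qed

text \<open>The admissibility condition of \<open>homogeneous_exponent\<close> for one integer row
  instead of a matrix; the existential over \<open>k\<close> replaces a maximum over the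
  forms.\<close>

definition forms_bounded_below :: "(real^'n)^'p \<Rightarrow> real \<Rightarrow> bool" where
  "forms_bounded_below x u \<longleftrightarrow> (\<exists>c>0. \<forall>m::int^'n. m \<noteq> 0 \<longrightarrow>
     (\<exists>k. \<bar>real_vec m \<bullet> x $ k\<bar> > c * infnorm (real_vec m) powr (- u)))"

text \<open>Non-zero integer vectors have norm at least 1, so a larger exponent gives a weaker
  bound.\<close>

lemma forms_bounded_below_mono:
  assumes "forms_bounded_below x u" "u \<le> u'"
  shows "forms_bounded_below x u'"
proof -
  obtain c where c: "c > 0" "\<And>m::int^'a. m \<noteq> 0 \<Longrightarrow>
      \<exists>k. \<bar>real_vec m \<bullet> x $ k\<bar> > c * infnorm (real_vec m) powr (- u)"
    using assms(1) unfolding forms_bounded_below_def by blast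
  have "\<exists>k. \<bar>real_vec m \<bullet> x $ k\<bar> > c * infnorm (real_vec m) powr (- u')" if "m \<noteq> 0" for m :: "int^'a"
  proof -
    have "c * infnorm (real_vec m) powr (- u') \<le> c * infnorm (real_vec m) powr (- u)"
      using c(1) assms(2) infnorm_real_vec_ge_1[OF that] by (intro mult_left_mono powr_mono) auto
    then show ?thesis using c(2)[OF that] by (meson le_less_trans)
  qed
  then show ?thesis unfolding forms_bounded_below_def using c(1) by blast
qed

text \<open>The rows of a matrix act separately on the tuple. In one direction the matrix with all
  rows equal to \<open>m\<close> is used; in the other, a row of largest norm alone makes the image
  large enough.\<close>

lemma matrix_bounded_below_iff:
  fixes x :: "(real^'n)^'p"
  shows "(\<exists>c>0. \<forall>\<omega>::int^'n^'n. \<omega> \<noteq> 0 \<longrightarrow> max_norm (act \<omega> x) > c * max_norm (real_mat \<omega>) powr (- u))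
    \<longleftrightarrow> forms_bounded_below x u"
proof -
  have "(\<forall>\<omega>::int^'n^'n. \<omega> \<noteq> 0 \<longrightarrow> max_norm (act \<omega> x) > c * max_norm (real_mat \<omega>) powr (- u)) \<longleftrightarrow>
      (\<forall>m::int^'n. m \<noteq> 0 \<longrightarrow> (\<exists>k. \<bar>real_vec m \<bullet> x $ k\<bar> > c * infnorm (real_vec m) powr (- u)))"
    (is "?A \<longleftrightarrow> ?B") for c
  proof
    assume ?A
    show ?B
    proof (intro allI impI)
      fix m :: "int^'n" assume "m \<noteq> 0"
      define \<omega> :: "int^'n^'n" where "\<omega> = (\<chi> i. m)"
      have "\<omega> \<noteq> 0" using \<open>m \<noteq> 0\<close> by (simp add: \<omega>_def vec_eq_iff)
      moreover have "max_norm (real_mat \<omega>) = infnorm (real_vec m)"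
        by (rule max_norm_row_attained[of \<omega>]) (simp add: \<omega>_def)
      ultimately have "max_norm (act \<omega> x) > c * infnorm (real_vec m) powr (- u)"
        using \<open>?A\<close> by metis
      moreover obtain k i where "max_norm (act \<omega> x) = \<bar>act \<omega> x $ k $ i\<bar>"
        by (rule max_norm_attained)
      ultimately show "\<exists>k. \<bar>real_vec m \<bullet> x $ k\<bar> > c * infnorm (real_vec m) powr (- u)"
        by (auto simp: act_nth \<omega>_def)
    qed
  next
    assume ?B
    show ?A
    proof (intro allI impI)
      fix \<omega> :: "int^'n^'n" assume "\<omega> \<noteq> 0"
      obtain i where i: "max_norm (real_mat \<omega>) = infnorm (real_vec (\<omega> $ i))"
        by (rule max_norm_row_attained)
      have "\<omega> $ i \<noteq> 0"
      proof
        assume "\<omega> $ i = 0"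
        then have "infnorm (real_vec (\<omega> $ l)) \<le> 0" for l
          using infnorm_row_le_max_norm[of \<omega> l] i by (simp add: infnorm_0)
        then have "\<omega> $ l = 0" for l
          using infnorm_real_vec_ge_1[of "\<omega> $ l"] by (metis not_one_le_zero order_trans)
        then show False using \<open>\<omega> \<noteq> 0\<close> by (simp add: vec_eq_iff)
      qed
      then obtain k where "\<bar>real_vec (\<omega> $ i) \<bullet> x $ k\<bar> > c * max_norm (real_mat \<omega>) powr (- u)"
        using \<open>?B\<close> i by metis
      then show "max_norm (act \<omega> x) > c * max_norm (real_mat \<omega>) powr (- u)"
        using nth_le_max_norm[of "act \<omega> x" k i] by (simp add: act_nth)
    qed
  qed
  then show ?thesis by (simp add: forms_bounded_below_def)
qed

text \<open>Admissible exponents form an upward closed set, so its infimum is at most \<theta>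
  exactly when every exponent above \<theta> is admissible. Membership of \<theta> itself is not
  implied, hence the \<epsilon>.\<close>

lemma not_projectively_very_well_approximable_iff:
  fixes x :: "(real^'n)^'p"
  defines "\<theta> \<equiv> (real CARD('n) - real CARD('p)) / real CARD('p)"
  shows "\<not> projectively_very_well_approximable x \<longleftrightarrow> (\<forall>\<epsilon>>0. forms_bounded_below x (\<theta> + \<epsilon>))"
proof -
  have "\<not> projectively_very_well_approximable x \<longleftrightarrow> Inf (ereal ` {u. forms_bounded_below x u}) \<le> ereal \<theta>"
    by (simp add: projectively_very_well_approximable_def homogeneous_exponent_def
        matrix_bounded_below_iff \<theta>_def not_less)
  also have "\<dots> \<longleftrightarrow> (\<forall>\<epsilon>>0. forms_bounded_below x (\<theta> + \<epsilon>))"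
  proof (intro iffI allI impI)
    fix \<epsilon> :: real
    assume le: "Inf (ereal ` {u. forms_bounded_below x u}) \<le> ereal \<theta>" and "\<epsilon> > 0"
    then have "Inf (ereal ` {u. forms_bounded_below x u}) < ereal (\<theta> + \<epsilon>)"
      by (meson ereal_less(2) le_less_trans less_add_same_cancel1 less_ereal.simps(1))
    then obtain u where "forms_bounded_below x u" "u < \<theta> + \<epsilon>"
      unfolding Inf_less_iff by auto
    then show "forms_bounded_below x (\<theta> + \<epsilon>)"
      using forms_bounded_below_mono less_imp_le by blast
  next
    assume "\<forall>\<epsilon>>0. forms_bounded_below x (\<theta> + \<epsilon>)"
    then have le: "Inf (ereal ` {u. forms_bounded_below x u}) \<le> ereal \<theta> + ereal \<epsilon>" if "\<epsilon> > 0" for \<epsilon>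
      using that by (intro Inf_lower) auto
    show "Inf (ereal ` {u. forms_bounded_below x u}) \<le> ereal \<theta>"
      by (rule ereal_le_epsilon2) (rule le)
  qed
  finally show ?thesis .
qed

section \<open>Extension to a basis and the scaled lattice\<close>

lemma invertible_if_ker_0:
  fixes A :: "real^'n^'n"
  assumes "\<And>v. A *v v = 0 \<Longrightarrow> v = 0"
  shows "invertible A"
  using assms matrix_left_invertible_ker[of A] by (simp add: invertible_left_inverse)

text \<open>The rows of \<open>P\<close> are a basis containing the tuple, so \<open>P *v v\<close>
  lists the values at \<open>v\<close> of \<open>n\<close> independent forms, the given ones
  standing at the positions \<open>\<iota> k\<close>.\<close>

lemma extend_to_invertible:
  fixes x :: "(real^'n)^'p"
  assumes "linearly_independent_tuple x"
  obtains P :: "real^'n^'n" and \<iota> :: "'p \<Rightarrow> 'n" where "invertible P" "inj \<iota>" "\<And>k. P $ \<iota> k = x $ k"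
proof -
  have inj: "inj (($) x)" and ind: "independent (range (($) x))"
    using assms by (auto simp: linearly_independent_tuple_def)
  obtain B where B: "range (($) x) \<subseteq> B" "independent B" "span B = (UNIV :: (real^'n) set)"
    using maximal_independent_subset_extend[OF subset_UNIV ind] by (metis top.extremum_uniqueI)
  have "finite B" using B(2) independent_imp_finite by blast
  moreover have "card B = CARD('n)"
    using dim_eq_card[of B UNIV] B by simp
  ultimately obtain g :: "'n \<Rightarrow> real^'n" where g: "bij_betw g UNIV B"
    using finite_same_card_bij[of "UNIV :: 'n set" B] by auto
  define P :: "real^'n^'n" where "P = (\<chi> i. g i)"
  have "\<exists>i. g i = x $ k" for k
    using B(1) g unfolding bij_betw_def by (metis range_subsetD imageE)
  then obtain \<iota> where \<iota>: "\<And>k. g (\<iota> k) = x $ k" by metis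
  have ker: "v = 0" if "P *v v = 0" for v
  proof -
    have "g i \<bullet> v = 0" for i
      using that by (simp add: P_def matrix_vector_mult_def vec_eq_iff inner_vec_def)
    then have "orthogonal v b" if "b \<in> B" for b
      using that g unfolding bij_betw_def orthogonal_def by (metis imageE inner_commute)
    then have "orthogonal v v"
      using orthogonal_to_span[of v B v] B(3) by auto
    then show ?thesis by (simp add: orthogonal_def)
  qed
  have "invertible P" by (rule invertible_if_ker_0) (use ker in blast)
  moreover have "inj \<iota>" by (metis \<iota> inj injD injI)
  ultimately show ?thesis using that[of P \<iota>] \<iota> by (simp add: P_def)
qed

lemma invertible_infnorm_bound:
  fixes P :: "real^'n^'n"
  assumes "invertible P"
  obtains A where "A \<ge> 1" "\<And>v. infnorm v \<le> A * infnorm (P *v v)"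
proof -
  obtain P' where P': "P' ** P = mat 1" using assms by (metis invertible_def)
  obtain K where K: "K > 0" "\<And>w. norm (P' *v w) \<le> norm w * K"
    using bounded_linear.pos_bounded[OF matrix_vector_mul_bounded_linear[of P']] by blast
  have "infnorm v \<le> max 1 (sqrt DIM(real^'n) * K) * infnorm (P *v v)" for v
  proof -
    have "infnorm v \<le> norm (P' *v (P *v v))"
      by (simp add: matrix_vector_mul_assoc P' infnorm_le_norm)
    also have "\<dots> \<le> norm (P *v v) * K" by (rule K)
    also have "\<dots> \<le> (sqrt DIM(real^'n) * infnorm (P *v v)) * K"
      using K(1) norm_le_infnorm[of "P *v v"] by (intro mult_right_mono) auto
    also have "\<dots> = (sqrt DIM(real^'n) * K) * infnorm (P *v v)" by simp
    also have "\<dots> \<le> max 1 (sqrt DIM(real^'n) * K) * infnorm (P *v v)"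
      by (intro mult_right_mono infnorm_pos_le) simp
    finally show ?thesis .
  qed
  then show ?thesis by (intro that[of "max 1 (sqrt DIM(real^'n) * K)"]) auto
qed

lemma measure_cube_image_scaled_rows:
  fixes P :: "real^'n^'n"
  shows "measure lebesgue ((*v) (\<chi> i. s i *\<^sub>R P $ i) ` cbox a b) =
    \<bar>prod s UNIV\<bar> * measure lebesgue ((*v) P ` cbox a b)"
proof -
  have "(*v) (\<chi> i. s i *\<^sub>R P $ i) ` cbox a b = (\<lambda>z. \<chi> k. s k * z $ k) ` (*v) P ` cbox a b"
    by (simp add: image_image matrix_vector_mult_def sum_distrib_left mult_ac)
  then show ?thesis
    by (simp add: measure_stretch measurable_linear_image_interval)
qed

text \<open>The scaled lattice has covolume of order \<open>\<delta>^(-p) * T^(p - n)\<close>, that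
  is \<open>T powr e\<close>, which also bounds its covering radius. Undoing the scaling gives error
  of order \<delta> times this, hence \<open>T powr (e - u)\<close>, and size of order
  \<open>T powr (1 + e)\<close>.\<close>

lemma quantitative_orbit_approximation:
  fixes x y :: "(real^'n)^'p"
  assumes indep: "linearly_independent_tuple x" and below: "forms_bounded_below x u"
    and pn: "CARD('p) < CARD('n)" and "u \<ge> 0"
  defines "e \<equiv> real CARD('p) * u - (real CARD('n) - real CARD('p))"
  assumes "e \<ge> 0"
  obtains C where "C > 0"
    and "\<And>T. T \<ge> 1 \<Longrightarrow> \<exists>\<gamma>\<in>Gamma. max_norm (act \<gamma> x - y) \<le> C * T powr (e - u) \<and>
           max_norm (real_mat \<gamma>) \<le> C * T powr (1 + e)"
proof -
  obtain P :: "real^'n^'n" and \<iota> :: "'p \<Rightarrow> 'n" where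
    P: "invertible P" and \<iota>: "inj \<iota>" and P\<iota>: "\<And>k. P $ \<iota> k = x $ k"
    using extend_to_invertible[OF indep] by blast
  obtain P' where P': "P ** P' = mat 1" using P by (metis invertible_def)
  have P_nth: "(P *v v) $ i = P $ i \<bullet> v" for v i
    by (simp add: matrix_vector_mult_def inner_vec_def)
  obtain A where A: "A \<ge> 1" "\<And>v. infnorm v \<le> A * infnorm (P *v v)"
    using invertible_infnorm_bound[OF P] by blast
  obtain c0 where c0: "c0 > 0" "\<And>m::int^'n. m \<noteq> 0 \<Longrightarrow>
      \<exists>k. \<bar>real_vec m \<bullet> x $ k\<bar> > c0 * infnorm (real_vec m) powr (- u)"
    using below unfolding forms_bounded_below_def by blast
  define c where "c = min c0 1"
  have "0 < c" "c \<le> c0" "c \<le> 1" using c0 by (auto simp: c_def)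
  \<comment> \<open>\<open>V\<close> sends each \<open>x $ k\<close> to the vector with entries
    \<open>y $ k $ i\<close> and every other basis vector to 0. Since \<open>p < n\<close> there is
    such a vector, so \<open>V\<close> is singular.\<close>
  define V :: "real^'n^'n" where
    "V = (\<chi> i. P' *v (\<chi> l. if l \<in> range \<iota> then y $ (inv \<iota> l) $ i else 0))"
  have PV: "P $ l \<bullet> V $ i = (if l \<in> range \<iota> then y $ (inv \<iota> l) $ i else 0)" for l i
    by (simp add: V_def matrix_vector_mul_assoc P' flip: P_nth)
  have xV: "x $ k \<bullet> V $ i = y $ k $ i" for k i
    using PV[of "\<iota> k" i] \<iota> by (simp add: P\<iota>)
  have det_V: "det V = 0"
  proof -
    have "card (range \<iota>) < CARD('n)" using pn by (simp add: card_image[OF \<iota>])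
    then obtain l where l: "l \<notin> range \<iota>" by (metis UNIV_eq_I less_irrefl)
    have "V *v (P $ l) = 0"
      using PV[of l] l by (simp add: vec_eq_iff matrix_vector_mult_def inner_vec_def mult.commute)
    moreover have "P $ l \<noteq> 0"
      using P det_zero_row(1)[of l P] by (auto simp: row_def invertible_det_nz vec_eq_iff)
    ultimately have "\<not> invertible V"
      using matrix_left_invertible_ker[of V] by (auto simp: invertible_left_inverse)
    then show ?thesis by (simp add: invertible_det_nz)
  qed
  obtain \<kappa> where "\<kappa> > 0" and \<kappa>: "\<And>(L::real^'n^'n) D.
      \<lbrakk>invertible L; \<And>v. \<exists>m::int^'n. infnorm (L *v (real_vec m - v)) < D\<rbrakk> \<Longrightarrow>
      \<exists>\<gamma>::int^'n^'n. det \<gamma> > 0 \<and> (\<forall>i. infnorm (L *v (real_vec (\<gamma> $ i) - V $ i)) < \<kappa> * D)"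
    using integer_matrix_near_singular[OF det_V] by blast
  define \<mu> where "\<mu> = measure lebesgue ((*v) P ` cbox (\<chi> i. - (1/2)) (\<chi> i. 1/2))"
  have "\<mu> \<ge> 0" by (simp add: \<mu>_def)
  \<comment> \<open>This is the factor of the covolume that does not depend on
    \<open>T\<close>.\<close>
  define C1 where "C1 = \<mu> * (A powr u / c) ^ CARD('p)"
  have "C1 \<ge> 0" using \<open>\<mu> \<ge> 0\<close> \<open>0 < c\<close> by (simp add: C1_def)
  define v0 where "v0 = max_norm V"
  define C where "C = 1 + \<kappa> * C1 + (v0 + A * \<kappa> * C1)"
  have "v0 \<ge> 0" using nth_le_max_norm[of V] unfolding v0_def by (meson abs_ge_zero order_trans)
  have C_ge: "C > 0" "\<kappa> * C1 \<le> C" "v0 + A * \<kappa> * C1 \<le> C"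
    using \<open>\<kappa> > 0\<close> \<open>C1 \<ge> 0\<close> \<open>v0 \<ge> 0\<close> A(1) by (auto simp: C_def add_pos_nonneg)
  have main: "\<exists>\<gamma>\<in>Gamma. max_norm (act \<gamma> x - y) \<le> C * T powr (e - u) \<and>
      max_norm (real_mat \<gamma>) \<le> C * T powr (1 + e)" if "T \<ge> 1" for T
  proof -
    \<comment> \<open>If all forms at \<open>m\<close> are at most \<open>T\<close>, then
      \<open>m\<close> has norm at most \<open>A * T\<close>, so the hypothesis makes some form of
      \<open>x\<close> exceed \<delta>. The cap \<open>c \<le> 1\<close> also ensures
      \<open>\<delta> \<le> T powr (- u)\<close> and \<open>\<delta> \<le> T\<close>.\<close>
    define \<delta> where "\<delta> = c * (A * T) powr (- u)"
    have AT: "A * T \<ge> 1" using A(1) \<open>T \<ge> 1\<close> mult_mono[of 1 A 1 T] by simp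
    have "\<delta> > 0" using \<open>0 < c\<close> AT unfolding \<delta>_def by (intro mult_pos_pos) auto
    have "(A * T) powr (- u) \<le> 1"
      using powr_mono[of "- u" 0 "A * T"] AT \<open>u \<ge> 0\<close> by (auto split: if_splits)
    then have \<delta>_le: "\<delta> \<le> T powr (- u)" "\<delta> \<le> T"
    proof -
      have "(A * T) powr (- u) \<le> T powr (- u)"
        using A(1) \<open>T \<ge> 1\<close> \<open>u \<ge> 0\<close> by (intro powr_mono2') auto
      then show "\<delta> \<le> T powr (- u)"
        using \<open>c \<le> 1\<close> \<open>0 < c\<close> by (simp add: \<delta>_def mult_le_one order_trans[OF mult_left_le_one_le])
      show "\<delta> \<le> T"
        using \<open>(A * T) powr (- u) \<le> 1\<close> \<open>c \<le> 1\<close> \<open>0 < c\<close> \<open>T \<ge> 1\<close>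
        by (simp add: \<delta>_def order_trans[OF mult_le_one])
    qed
    define r where "r i = (if i \<in> range \<iota> then \<delta> else T)" for i
    have r: "0 < r i" "r i \<le> T" for i using \<open>\<delta> > 0\<close> \<delta>_le \<open>T \<ge> 1\<close> by (auto simp: r_def)
    define L :: "real^'n^'n" where "L = (\<chi> i. (1 / r i) *\<^sub>R P $ i)"
    have L_nth: "(L *v v) $ i = (P $ i \<bullet> v) / r i" for v i
      by (simp add: L_def matrix_vector_mult_def inner_vec_def sum_divide_distrib)
    have inv_L: "invertible L"
    proof (rule invertible_if_ker_0)
      fix v assume "L *v v = 0"
      then have "P $ i \<bullet> v = 0" for i
        using L_nth[of v i] r(1)[of i] by simp
      then have "P *v v = 0" by (simp add: vec_eq_iff P_nth)
      then have "infnorm v \<le> 0" using A(2)[of v] by (simp add: infnorm_0)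
      then show "v = 0" using infnorm_pos_le[of v] infnorm_eq_0[of v] by linarith
    qed
    define D where "D = measure lebesgue ((*v) L ` cbox (\<chi> i. - (1/2)) (\<chi> i. 1/2))"
    have D_eq: "D = C1 * T powr e"
    proof -
      have "D = \<bar>\<Prod>i\<in>UNIV. 1 / r i\<bar> * \<mu>"
        unfolding D_def L_def \<mu>_def by (rule measure_cube_image_scaled_rows)
      also have "(\<Prod>i\<in>UNIV. 1 / r i) = (\<Prod>i\<in>UNIV. if i \<in> range \<iota> then 1 / \<delta> else 1 / T)"
        by (rule prod.cong) (auto simp: r_def)
      also have "\<dots> = (1 / \<delta>) ^ card (range \<iota>) * (1 / T) ^ card (- range \<iota>)"
        by (simp add: prod.If_cases)
      also have "card (range \<iota>) = CARD('p)" by (rule card_image[OF \<iota>])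
      also have "card (- range \<iota>) = CARD('n) - CARD('p)"
        by (simp add: Compl_eq_Diff_UNIV card_Diff_subset card_image[OF \<iota>])
      also have "(1 / T) ^ (CARD('n) - CARD('p)) = T powr (- (real CARD('n) - real CARD('p)))"
      proof -
        have "real CARD('n) - real CARD('p) = real (CARD('n) - CARD('p))" using pn by simp
        moreover have "T powr real (CARD('n) - CARD('p)) = T ^ (CARD('n) - CARD('p))"
          using \<open>T \<ge> 1\<close> by (intro powr_realpow) auto
        ultimately show ?thesis by (simp only: powr_minus_divide power_one_over)
      qed
      also have "1 / \<delta> = (A powr u / c) * T powr u"
        using A(1) \<open>T \<ge> 1\<close> by (simp add: \<delta>_def powr_mult powr_minus field_simps)
      also have "((A powr u / c) * T powr u) ^ CARD('p) = (A powr u / c) ^ CARD('p) * T powr (real CARD('p) * u)"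
      proof -
        have "(T powr u) ^ CARD('p) = T powr (real CARD('p) * u)"
          using \<open>T \<ge> 1\<close> by (subst powr_realpow[symmetric]) (auto simp: powr_powr mult.commute)
        then show ?thesis by (simp only: power_mult_distrib)
      qed
      finally have "D = \<bar>(A powr u / c) ^ CARD('p) * (T powr (real CARD('p) * u) *
          T powr (- (real CARD('n) - real CARD('p))))\<bar> * \<mu>"
        by (simp add: mult.assoc)
      also have "T powr (real CARD('p) * u) * T powr (- (real CARD('n) - real CARD('p))) = T powr e"
        unfolding powr_add[symmetric] by (rule arg_cong[of _ _ "(powr) T"]) (simp add: e_def)
      also have "\<bar>(A powr u / c) ^ CARD('p) * T powr e\<bar> * \<mu> = C1 * T powr e"
        using \<open>0 < c\<close> by (simp add: C1_def abs_mult mult_ac)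
      finally show ?thesis .
    qed
    have lattice_min: "infnorm (L *v real_vec m) \<ge> 1" if nz: "m \<noteq> 0" for m
    proof (rule ccontr)
      assume "\<not> infnorm (L *v real_vec m) \<ge> 1"
      then have *: "\<bar>(L *v real_vec m) $ i\<bar> < 1" for i by (metis infnorm_less_iff not_le)
      have less: "\<bar>P $ i \<bullet> real_vec m\<bar> < r i" for i
      proof -
        have "\<bar>P $ i \<bullet> real_vec m\<bar> / r i < 1"
          using *[of i] r(1)[of i] by (simp add: L_nth abs_divide)
        then show ?thesis using r(1)[of i] by (simp add: pos_divide_less_eq)
      qed
      have "infnorm (P *v real_vec m) \<le> T"
        unfolding infnorm_le_iff P_nth using less r(2) by (meson less_imp_le order_trans)
      then have "infnorm (real_vec m) \<le> A * T"
        using A by (meson mult_left_mono order_trans zero_le_one)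
      then have "(A * T) powr (- u) \<le> infnorm (real_vec m) powr (- u)"
        using infnorm_real_vec_ge_1[OF nz] \<open>u \<ge> 0\<close> by (intro powr_mono2') auto
      then have "\<delta> \<le> c0 * infnorm (real_vec m) powr (- u)"
        unfolding \<delta>_def using \<open>0 < c\<close> \<open>c \<le> c0\<close> by (intro mult_mono) auto
      moreover obtain k where "\<bar>real_vec m \<bullet> x $ k\<bar> > c0 * infnorm (real_vec m) powr (- u)"
        using c0(2)[OF nz] by blast
      ultimately show False
        using less[of "\<iota> k"] by (simp add: P\<iota> r_def inner_commute)
    qed
    have "\<exists>m::int^'n. infnorm (L *v (real_vec m - v)) < D" for v
      using lattice_covering[OF inv_L lattice_min, of "L *v v"]
      unfolding D_def by (simp add: matrix_vector_mult_diff_distrib)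
    from \<kappa>[OF inv_L this] obtain \<gamma> :: "int^'n^'n" where \<gamma>: "det \<gamma> > 0"
      "\<And>i. infnorm (L *v (real_vec (\<gamma> $ i) - V $ i)) < \<kappa> * D" by blast
    have close: "\<bar>P $ l \<bullet> (real_vec (\<gamma> $ i) - V $ i)\<bar> < \<kappa> * D * r l" for l i
    proof -
      have "\<bar>(L *v (real_vec (\<gamma> $ i) - V $ i)) $ l\<bar> < \<kappa> * D"
        using \<gamma>(2)[of i] infnorm_less_iff by blast
      then show ?thesis using r(1)[of l] by (simp add: L_nth abs_divide pos_divide_less_eq)
    qed
    have "D \<ge> 0" by (simp add: D_def)
    have "max_norm (act \<gamma> x - y) \<le> C * T powr (e - u)"
      unfolding max_norm_le_iff
    proof (intro allI)
      fix k i
      have "\<bar>(act \<gamma> x - y) $ k $ i\<bar> = \<bar>P $ \<iota> k \<bullet> (real_vec (\<gamma> $ i) - V $ i)\<bar>"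
        using xV[of k i] by (simp add: act_nth P\<iota> inner_diff_right inner_commute)
      also have "\<dots> \<le> \<kappa> * D * \<delta>"
        using close[of "\<iota> k" i] by (simp add: r_def)
      also have "\<dots> \<le> \<kappa> * D * T powr (- u)"
        using \<delta>_le(1) \<open>\<kappa> > 0\<close> \<open>D \<ge> 0\<close> by (intro mult_left_mono) auto
      also have "\<dots> = \<kappa> * C1 * T powr (e - u)"
        by (simp add: D_eq mult_ac powr_diff powr_minus divide_inverse)
      also have "\<dots> \<le> C * T powr (e - u)"
        using C_ge(2) by (intro mult_right_mono) auto
      finally show "\<bar>(act \<gamma> x - y) $ k $ i\<bar> \<le> C * T powr (e - u)" .
    qed
    moreover have "max_norm (real_mat \<gamma>) \<le> C * T powr (1 + e)"
    proof -
      obtain i where i: "max_norm (real_mat \<gamma>) = infnorm (real_vec (\<gamma> $ i))"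
        by (rule max_norm_row_attained)
      have "infnorm (P *v (real_vec (\<gamma> $ i) - V $ i)) \<le> \<kappa> * D * T"
        unfolding infnorm_le_iff P_nth
      proof
        fix l
        have "\<kappa> * D * r l \<le> \<kappa> * D * T"
          using \<open>\<kappa> > 0\<close> \<open>D \<ge> 0\<close> r(2) by (intro mult_left_mono) auto
        then show "\<bar>P $ l \<bullet> (real_vec (\<gamma> $ i) - V $ i)\<bar> \<le> \<kappa> * D * T"
          using close[of l i] by linarith
      qed
      then have "infnorm (real_vec (\<gamma> $ i) - V $ i) \<le> A * (\<kappa> * D * T)"
        using A by (meson mult_left_mono order_trans zero_le_one)
      moreover have "infnorm (V $ i) \<le> v0"
        unfolding infnorm_le_iff v0_def using nth_le_max_norm by blast
      moreover have "infnorm (real_vec (\<gamma> $ i)) \<le> infnorm (real_vec (\<gamma> $ i) - V $ i) + infnorm (V $ i)"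
        using infnorm_triangle[of "real_vec (\<gamma> $ i) - V $ i" "V $ i"] by simp
      ultimately have "infnorm (real_vec (\<gamma> $ i)) \<le> v0 + A * (\<kappa> * D * T)" by linarith
      also have "A * (\<kappa> * D * T) = A * \<kappa> * C1 * T powr (1 + e)"
        using \<open>T \<ge> 1\<close> by (simp add: D_eq powr_add)
      \<comment> \<open>The fixed contribution of \<open>V\<close> is absorbed since
        \<open>T powr (1 + e)\<close> is at least 1.\<close>
      also have "v0 \<le> v0 * T powr (1 + e)"
        using \<open>v0 \<ge> 0\<close> \<open>T \<ge> 1\<close> \<open>e \<ge> 0\<close> ge_one_powr_ge_zero[of T "1 + e"] mult_left_mono[of 1 "T powr (1 + e)" v0] by simp
      finally have "infnorm (real_vec (\<gamma> $ i)) \<le> (v0 + A * \<kappa> * C1) * T powr (1 + e)"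
        by (simp add: algebra_simps)
      also have "\<dots> \<le> C * T powr (1 + e)"
        using C_ge(3) by (intro mult_right_mono) auto
      finally show ?thesis by (simp add: i)
    qed
    ultimately show ?thesis using \<gamma>(1) by (auto simp: Gamma_def)
  qed
  show ?thesis by (rule that[OF C_ge(1) main])
qed

text \<open>Finitely many solutions would stay at a positive distance from \<open>y\<close>, because
  \<open>y\<close> lies outside the orbit. The quantitative estimate for large \<open>T\<close>
  supplies a solution closer than that.\<close>

theorem orbit_approximation_property_if_forms_bounded_below:
  fixes x :: "(real^'n)^'p"
  defines "\<theta> \<equiv> (real CARD('n) - real CARD('p)) / real CARD('p)"
  assumes indep: "linearly_independent_tuple x" and pn: "CARD('p) < CARD('n)"
    and below: "\<And>\<epsilon>. \<epsilon> > 0 \<Longrightarrow> forms_bounded_below x (\<theta> + \<epsilon>)"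
  shows "orbit_approximation_property x"
  unfolding orbit_approximation_property_def
proof (intro allI impI notI)
  fix \<rho> :: real and y :: "(real^'n)^'p"
  assume \<rho>: "\<rho> < (real CARD('n) - real CARD('p)) / real CARD('p)"
    and y: "y \<notin> (\<lambda>\<gamma>. act \<gamma> x) ` Gamma"
  define G :: "(int^'n^'n) set" where
    "G = {\<gamma> \<in> Gamma. max_norm (act \<gamma> x - y) < max_norm (real_mat \<gamma>) powr (- \<rho>)}"
  assume "finite {\<gamma> \<in> Gamma. max_norm (act \<gamma> x - y) < max_norm (real_mat \<gamma>) powr (- \<rho>)}"
  then have fin: "finite G" by (simp add: G_def)
  have p_pos: "real CARD('p) > 0" by simp
  have "\<theta> > 0" using pn by (simp add: \<theta>_def)
  \<comment> \<open>A non-negative exponent is required to turn an upper bound for the norm of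
    \<gamma> into a lower bound for its negative power. It stays below \<theta> as \<theta> is
    positive.\<close>
  define \<sigma> where "\<sigma> = max \<rho> 0"
  have \<sigma>: "0 \<le> \<sigma>" "\<rho> \<le> \<sigma>" "\<sigma> < \<theta>" using \<rho> \<open>\<theta> > 0\<close> by (auto simp: \<sigma>_def \<theta>_def)
  \<comment> \<open>Chosen so that \<open>e * (1 + \<sigma>)\<close> is half the gap
    \<open>\<theta> - \<sigma>\<close>; then \<open>e - u + \<sigma> * (1 + e)\<close> equals
    \<open>- (\<theta> - \<sigma>) / 2 - \<epsilon>\<close>.\<close>
  define \<epsilon> where "\<epsilon> = (\<theta> - \<sigma>) / 2 / (real CARD('p) * (1 + \<sigma>))"
  have "\<epsilon> > 0" using \<sigma> by (simp add: \<epsilon>_def)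
  define u where "u = \<theta> + \<epsilon>"
  define e where "e = real CARD('p) * u - (real CARD('n) - real CARD('p))"
  have e_eq: "e = real CARD('p) * \<epsilon>"
    by (simp add: e_def u_def \<theta>_def field_simps)
  have "e * (1 + \<sigma>) = (\<theta> - \<sigma>) / 2"
  proof -
    have "e * (1 + \<sigma>) = (real CARD('p) * (1 + \<sigma>)) * \<epsilon>" by (simp add: e_eq)
    moreover have "real CARD('p) * (1 + \<sigma>) \<noteq> 0" using \<sigma>(1) p_pos by simp
    moreover have "X * (a / X) = a" if "X \<noteq> 0" for X a :: real using that by simp
    ultimately show ?thesis unfolding \<epsilon>_def by (simp only:)
  qed
  then have neg: "e - u + \<sigma> * (1 + e) < 0"
    using \<sigma>(3) \<open>\<epsilon> > 0\<close> by (simp add: u_def algebra_simps)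
  have "e \<ge> 0" using \<open>\<epsilon> > 0\<close> by (simp add: e_eq)
  have neg': "e - u < 0"
    using neg mult_nonneg_nonneg[of \<sigma> "1 + e"] \<sigma>(1) \<open>e \<ge> 0\<close> by linarith
  obtain C where "C > 0" and C: "\<And>T. T \<ge> 1 \<Longrightarrow> \<exists>\<gamma>\<in>Gamma.
      max_norm (act \<gamma> x - y) \<le> C * T powr (e - u) \<and> max_norm (real_mat \<gamma>) \<le> C * T powr (1 + e)"
    using quantitative_orbit_approximation[OF indep below[OF \<open>\<epsilon> > 0\<close>] pn, of y] \<open>\<theta> > 0\<close> \<open>\<epsilon> > 0\<close> \<open>e \<ge> 0\<close>
    unfolding e_def u_def by (metis add_nonneg_nonneg less_imp_le)
  have pos: "max_norm (act \<gamma> x - y) > 0" if "\<gamma> \<in> Gamma" for \<gamma>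
  proof (rule ccontr)
    assume "\<not> max_norm (act \<gamma> x - y) > 0"
    then have "act \<gamma> x - y = 0"
      using max_norm_le_iff[of "act \<gamma> x - y" 0] by (simp add: vec_eq_iff)
    then show False using y that by auto
  qed
  \<comment> \<open>The inserted 1 keeps the minimum meaningful when \<open>G\<close> is
    empty.\<close>
  define \<mu> where "\<mu> = Min (insert 1 ((\<lambda>\<gamma>. max_norm (act \<gamma> x - y)) ` G))"
  have "\<mu> > 0" using fin pos by (auto simp: \<mu>_def G_def)
  have \<mu>: "\<mu> \<le> max_norm (act \<gamma> x - y)" if "\<gamma> \<in> G" for \<gamma>
    using fin that by (simp add: \<mu>_def)
  have "((\<lambda>T::real. T powr (e - u)) \<longlongrightarrow> 0) at_top"
    "((\<lambda>T::real. T powr (e - u + \<sigma> * (1 + e))) \<longlongrightarrow> 0) at_top"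
    using neg neg' by (auto intro: tendsto_neg_powr filterlim_ident)
  then have "\<forall>\<^sub>F T in at_top. T powr (e - u) < \<mu> / C"
    "\<forall>\<^sub>F T in at_top. T powr (e - u + \<sigma> * (1 + e)) < 1 / (C * C powr \<sigma>)"
    using \<open>\<mu> > 0\<close> \<open>C > 0\<close> by (auto intro: order_tendstoD)
  then have "\<forall>\<^sub>F T in at_top. T \<ge> 1 \<and> T powr (e - u) < \<mu> / C \<and>
      T powr (e - u + \<sigma> * (1 + e)) < 1 / (C * C powr \<sigma>)"
    using eventually_ge_at_top[of "1::real"] by eventually_elim auto
  then obtain T where T: "T \<ge> 1" "T powr (e - u) < \<mu> / C"
    "T powr (e - u + \<sigma> * (1 + e)) < 1 / (C * C powr \<sigma>)"
    using eventually_happens by fastforce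
  obtain \<gamma> where \<gamma>: "\<gamma> \<in> Gamma" "max_norm (act \<gamma> x - y) \<le> C * T powr (e - u)"
    "max_norm (real_mat \<gamma>) \<le> C * T powr (1 + e)"
    using C[OF T(1)] by blast
  \<comment> \<open>A positive determinant excludes zero rows, and a non-zero integer row has norm
    at least 1.\<close>
  have ge1: "max_norm (real_mat \<gamma>) \<ge> 1"
  proof -
    fix i :: 'n
    have "\<gamma> $ i \<noteq> 0"
      using \<gamma>(1) det_zero_row(1)[of i \<gamma>] by (auto simp: Gamma_def row_def vec_eq_iff)
    then show ?thesis
      using infnorm_real_vec_ge_1 infnorm_row_le_max_norm order_trans by blast
  qed
  have "C * T powr (e - u) < (C * T powr (1 + e)) powr (- \<sigma>)"
  proof -
    have "T powr (e - u) * (T powr (1 + e)) powr \<sigma> * (C * C powr \<sigma>) < 1"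
    proof -
      have "(T powr (1 + e)) powr \<sigma> = T powr (\<sigma> * (1 + e))" by (simp only: powr_powr mult.commute)
      then have "T powr (e - u) * (T powr (1 + e)) powr \<sigma> = T powr (e - u + \<sigma> * (1 + e))"
        by (simp only: powr_add)
      then show ?thesis using T(3) \<open>C > 0\<close> by (simp only:) (simp add: pos_less_divide_eq)
    qed
    then have "C * T powr (e - u) * (C * T powr (1 + e)) powr \<sigma> < 1"
      using \<open>C > 0\<close> by (simp add: powr_mult mult_ac)
    then show ?thesis
      using \<open>C > 0\<close> T(1) by (simp add: powr_minus field_simps)
  qed
  also have "\<dots> \<le> max_norm (real_mat \<gamma>) powr (- \<sigma>)"
    using \<gamma>(3) ge1 \<sigma>(1) by (intro powr_mono2') auto
  also have "\<dots> \<le> max_norm (real_mat \<gamma>) powr (- \<rho>)"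
    using ge1 \<sigma>(2) by (intro powr_mono) auto
  finally have "\<gamma> \<in> G" using \<gamma> by (simp add: G_def)
  from \<mu>[OF this] \<gamma>(2) T(2) \<open>C > 0\<close> show False
    by (simp add: pos_less_divide_eq mult.commute)
qed

subsection \<open>Almost every tuple\<close>

lemma differentiable_vec:
  fixes f :: "'i::finite \<Rightarrow> 'a::real_normed_vector \<Rightarrow> 'b::euclidean_space"
  assumes "\<And>i. f i differentiable F"
  shows "(\<lambda>x. \<chi> i. f i x) differentiable F"
proof -
  have "linear (axis i :: 'b \<Rightarrow> 'b^'i)" for i
    by (intro linearI) (auto simp: axis_def vec_eq_iff)
  then have "bounded_linear (axis i :: 'b \<Rightarrow> 'b^'i)" for i
    by (simp add: linear_conv_bounded_linear)
  then have "(\<lambda>x. axis i (f i x) :: 'b^'i) differentiable F" for i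
    using assms unfolding differentiable_def by (metis bounded_linear.has_derivative)
  then have "(\<lambda>x. \<Sum>i\<in>UNIV. axis i (f i x) :: 'b^'i) differentiable F"
    by (intro differentiable_sum) auto
  moreover have "(\<Sum>i\<in>UNIV. axis i (f i x)) = (\<chi> i. f i x)" for x
    by (simp add: vec_eq_iff axis_def sum.delta)
  ultimately show ?thesis by simp
qed

text \<open>Independence of the family can fail in two ways. A relation on the set of vectors is
  solved for one of them; a repetition is itself a combination with a single coefficient 1.\<close>

lemma dependent_tuple_combination:
  fixes x :: "(real^'n)^'p"
  assumes "\<not> linearly_independent_tuple x"
  obtains i c where "x $ i = (\<Sum>k\<in>UNIV - {i}. c k *\<^sub>R x $ k)"
proof (cases "inj (($) x)")
  case True
  then have "dependent (range (($) x))"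
    using assms by (simp add: linearly_independent_tuple_def)
  then obtain b i where b: "b (x $ i) \<noteq> 0" "(\<Sum>v\<in>range (($) x). b v *\<^sub>R v) = 0"
    using dependent_finite[of "range (($) x)"] by auto
  have "(\<Sum>k\<in>UNIV. b (x $ k) *\<^sub>R x $ k) = 0"
    using b(2) by (simp add: sum.reindex[OF True])
  from linear_relation_solved[of "\<lambda>k. b (x $ k)", OF this b(1)] show ?thesis by (rule that)
next
  case False
  then obtain i j where ij: "i \<noteq> j" "x $ i = x $ j" by (auto simp: inj_on_def)
  then have "x $ i = (\<Sum>k\<in>UNIV - {i}. (if k = j then 1 else 0) *\<^sub>R x $ k)"
    by (simp add: if_distrib[of "\<lambda>a. a *\<^sub>R _"] sum.delta cong: if_cong)
  then show ?thesis by (rule that)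
qed

text \<open>A dependent tuple is determined by all but its \<open>i\<close>-th vector together with \<open>p - 1 < n\<close>
  coefficients; storing these in the free slot \<open>i\<close> presents the dependent tuples as smooth
  images of hyperplanes.\<close>

lemma negligible_dependent_tuples:
  assumes pn: "CARD('p::finite) < CARD('n::finite)"
  shows "negligible {x::(real^'n)^'p. \<not> linearly_independent_tuple x}"
proof -
  obtain \<iota> :: "'p \<Rightarrow> 'n" where \<iota>: "inj \<iota>"
    using card_le_inj[of "UNIV :: 'p set" "UNIV :: 'n set"] pn by auto
  \<comment> \<open>In slot \<open>i\<close> the coordinate \<open>\<iota> l\<close> stores the
    coefficient of the vector \<open>l\<close>. As \<open>l\<close> differs from \<open>i\<close>,
    the coordinate \<open>\<iota> i\<close> is free; setting it to 0 confines the parameters to a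
    hyperplane, whose differentiable image in the same dimension is null.\<close>
  define H :: "'p \<Rightarrow> ((real^'n)^'p) set" where "H i = {z. z $ i $ \<iota> i = 0}" for i
  define F :: "'p \<Rightarrow> (real^'n)^'p \<Rightarrow> (real^'n)^'p" where
    "F i z = (\<chi> k. if k = i then \<Sum>l\<in>UNIV - {i}. z $ i $ \<iota> l *\<^sub>R z $ l else z $ k)" for i z
  have "negligible (F i ` H i)" for i
  proof (rule negligible_differentiable_image_negligible)
    have "H i = {z. axis i (axis (\<iota> i) 1) \<bullet> z = 0}"
      by (simp add: H_def inner_axis')
    moreover have "axis i (axis (\<iota> i) (1::real)) \<noteq> 0" by (simp add: axis_eq_0_iff)
    ultimately show "negligible (H i)" using negligible_hyperplane by metis
    have nth: "(\<lambda>z. z $ k) differentiable (at w within S)" for k and w :: "(real^'n)^'p" and S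
      by (intro bounded_linear_imp_differentiable bounded_linear_vec_nth)
    have nth2: "(\<lambda>z. z $ k $ l) differentiable (at w within S)" for k l and w :: "(real^'n)^'p" and S
      by (intro bounded_linear_imp_differentiable bounded_linear_compose[OF bounded_linear_vec_nth bounded_linear_vec_nth])
    have "(\<lambda>z. if k = i then \<Sum>l\<in>UNIV - {i}. z $ i $ \<iota> l *\<^sub>R z $ l else z $ k)
        differentiable (at w within H i)" for k w
      by (cases "k = i") (auto intro!: differentiable_sum differentiable_scaleR nth nth2)
    then show "F i differentiable_on H i"
      unfolding differentiable_on_def F_def by (intro ballI differentiable_vec)
  qed simp
  then have "negligible (\<Union>i. F i ` H i)" by (intro negligible_Union) auto
  moreover have "{x::(real^'n)^'p. \<not> linearly_independent_tuple x} \<subseteq> (\<Union>i. F i ` H i)"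
  proof
    fix x :: "(real^'n)^'p" assume "x \<in> {x. \<not> linearly_independent_tuple x}"
    then obtain i c where c: "x $ i = (\<Sum>k\<in>UNIV - {i}. c k *\<^sub>R x $ k)"
      using dependent_tuple_combination by blast
    define z :: "(real^'n)^'p" where
      "z = (\<chi> k. if k = i then \<chi> l. if l \<in> \<iota> ` (UNIV - {i}) then c (inv \<iota> l) else 0 else x $ k)"
    have "\<iota> i \<notin> \<iota> ` (UNIV - {i})" using \<iota> by (auto dest: injD)
    then have "z \<in> H i" by (simp add: H_def z_def)
    moreover have "F i z = x"
    proof -
      have "(\<Sum>l\<in>UNIV - {i}. z $ i $ \<iota> l *\<^sub>R z $ l) = (\<Sum>l\<in>UNIV - {i}. c l *\<^sub>R x $ l)"
        using \<iota> by (intro sum.cong) (auto simp: z_def)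
      then show ?thesis by (simp add: F_def vec_eq_iff c) (simp add: z_def)
    qed
    ultimately show "x \<in> (\<Union>i. F i ` H i)" by blast
  qed
  ultimately show ?thesis by (rule negligible_subset)
qed

section \<open>Measure of the tuples with unusually small forms\<close>

lemma compact_max_norm_le: "compact {x::real^'a^'b. max_norm x \<le> R}"
proof -
  have "{x::real^'a^'b. max_norm x \<le> R} = (\<Inter>i j. {x. \<bar>x $ i $ j\<bar> \<le> R})"
    by (auto simp: max_norm_le_iff)
  moreover have "closed {x::real^'a^'b. \<bar>x $ i $ j\<bar> \<le> R}" for i j
    by (intro closed_Collect_le continuous_intros)
  ultimately have "closed {x::real^'a^'b. max_norm x \<le> R}" by (auto intro!: closed_INT)
  moreover have "bounded {x::real^'a^'b. max_norm x \<le> R}"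
    unfolding bounded_iff
  proof (intro exI ballI)
    fix x :: "real^'a^'b" assume "x \<in> {x. max_norm x \<le> R}"
    then have "\<bar>x $ i $ j\<bar> \<le> R" for i j by (simp add: max_norm_le_iff)
    then have "norm (x $ i) \<le> real CARD('a) * R" for i
      using norm_le_l1_cart[of "x $ i"] sum_bounded_above[of UNIV "\<lambda>j. \<bar>x $ i $ j\<bar>" R] by fastforce
    then have "(\<Sum>i\<in>UNIV. norm (x $ i)) \<le> real CARD('b) * (real CARD('a) * R)"
      using sum_bounded_above[of UNIV "\<lambda>i. norm (x $ i)"] by fastforce
    moreover have "norm x \<le> (\<Sum>i\<in>UNIV. norm (x $ i))"
      unfolding norm_vec_def by (rule L2_set_le_sum) simp
    ultimately show "norm x \<le> real CARD('b) * (real CARD('a) * R)" by linarith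
  qed
  ultimately show ?thesis by (simp add: compact_eq_bounded_closed)
qed

text \<open>A neighbourhood of the subspace of tuples orthogonal to \<open>m\<close>, cut off by
  \<open>R\<close> to have finite measure.\<close>

definition near_resonance :: "real \<Rightarrow> int^'n \<Rightarrow> real \<Rightarrow> ((real^'n)^'p) set" where
  "near_resonance R m \<eta> = {x. max_norm x \<le> R \<and> (\<forall>k. \<bar>real_vec m \<bullet> x $ k\<bar> \<le> \<eta>)}"

lemma near_resonance_lmeasurable:
  fixes m :: "int^'n"
  shows "(near_resonance R m \<eta> :: ((real^'n)^'p) set) \<in> lmeasurable"
proof (rule lmeasurable_compact)
  have "(near_resonance R m \<eta> :: ((real^'n)^'p) set) =
      {x. max_norm x \<le> R} \<inter> (\<Inter>k. {x. \<bar>real_vec m \<bullet> x $ k\<bar> \<le> \<eta>})"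
    by (auto simp: near_resonance_def)
  moreover have "closed {x::(real^'n)^'p. \<bar>real_vec m \<bullet> x $ k\<bar> \<le> \<eta>}" for k
    by (intro closed_Collect_le continuous_intros)
  ultimately show "compact (near_resonance R m \<eta> :: ((real^'n)^'p) set)"
    by (simp add: compact_Int_closed compact_max_norm_le closed_INT)
qed

text \<open>The set is packed by translations in the direction of a largest coordinate of \<open>m\<close>, which
  change each form \<open>m \<bullet> x\<^sub>k\<close> by multiples of \<open>3\<eta>\<close>.\<close>

lemma measure_near_resonance_le:
  fixes m :: "int^'n"
  assumes "m \<noteq> 0" "0 < \<eta>" "\<eta> \<le> 1/3"
  shows "measure lebesgue (near_resonance R m \<eta> :: ((real^'n)^'p) set) \<le>
    measure lebesgue {x::(real^'n)^'p. max_norm x \<le> R + 1} * (6 * \<eta> / infnorm (real_vec m)) ^ CARD('p)"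
proof -
  define M where "M = infnorm (real_vec m)"
  have "M \<ge> 1" using infnorm_real_vec_ge_1[OF assms(1)] by (simp add: M_def)
  have "M \<in> range (\<lambda>i. \<bar>real_vec m $ i\<bar>)"
    unfolding M_def infnorm_vec by (intro Max_in) auto
  then obtain i where i: "M = \<bar>real_vec m $ i\<bar>" by blast
  \<comment> \<open>A shift by \<open>s\<close> along the coordinate \<open>i\<close> changes the
    form by \<open>3 * \<eta>\<close> in absolute value, more than the width
    \<open>2 * \<eta>\<close> of the slab.\<close>
  define s where "s = 3 * \<eta> / M"
  \<comment> \<open>As \<open>Q * s \<le> 1\<close>, all shifts stay within the bound
    \<open>R + 1\<close>. The floor of a number at least 1 is at least half of it, so
    \<open>Q \<ge> M / (6 * \<eta>)\<close>, and the \<open>p\<close> vectors are shifted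
    independently.\<close>
  define Q where "Q = nat \<lfloor>M / (3 * \<eta>)\<rfloor>"
  have "M / (3 * \<eta>) \<ge> 1" using assms \<open>M \<ge> 1\<close> by simp
  then have Q: "real Q \<le> M / (3 * \<eta>)" "real Q \<ge> M / (6 * \<eta>)"
  proof -
    have "\<lfloor>z\<rfloor> \<ge> z / 2" if "z \<ge> 1" for z :: real
    proof -
      have "real_of_int \<lfloor>z\<rfloor> \<ge> 1" using that by simp
      then show ?thesis using floor_correct[of z] by linarith
    qed
    from this[OF \<open>M / (3 * \<eta>) \<ge> 1\<close>] have "of_int \<lfloor>M / (3 * \<eta>)\<rfloor> \<ge> M / (6 * \<eta>)" by simp
    then show "real Q \<ge> M / (6 * \<eta>)" unfolding Q_def by linarith
    show "real Q \<le> M / (3 * \<eta>)" using \<open>M / (3 * \<eta>) \<ge> 1\<close> unfolding Q_def by linarith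
  qed
  define I where "I = {q::int^'p. \<forall>k. q $ k \<in> {0..<int Q}}"
  define t :: "int^'p \<Rightarrow> (real^'n)^'p" where "t q = (\<chi> k. (real_of_int (q $ k) * s) *\<^sub>R axis i 1)" for q
  let ?A = "near_resonance R m \<eta> :: ((real^'n)^'p) set"
  let ?W = "{x::(real^'n)^'p. max_norm x \<le> R + 1}"
  have card_I: "card I = Q ^ CARD('p)" "finite I"
    unfolding I_def by (subst card_vec_Collect; simp) (rule card_vec_Collect; simp)
  have "real (card I) * measure lebesgue ?A \<le> measure lebesgue ?W"
  proof (rule measure_packing[where t = t])
    show "finite I" by fact
    show "?A \<in> lmeasurable" by (rule near_resonance_lmeasurable)
    show "?W \<in> lmeasurable" by (intro lmeasurable_compact compact_max_norm_le)
  next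
    fix q assume q: "q \<in> I"
    have shift: "\<bar>t q $ k $ l\<bar> \<le> 1" for k l
    proof -
      have "0 \<le> q $ k" "q $ k \<le> int Q" using q by (auto simp: I_def less_imp_le)
      then have "0 \<le> real_of_int (q $ k)" "real_of_int (q $ k) \<le> M / (3 * \<eta>)" using Q(1) by linarith+
      moreover have "s > 0" "M / (3 * \<eta>) * s = 1" using \<open>M \<ge> 1\<close> assms(2) by (auto simp: s_def)
      ultimately have "0 \<le> real_of_int (q $ k) * s" "real_of_int (q $ k) * s \<le> 1"
        using mult_right_mono[of "real_of_int (q $ k)" "M / (3 * \<eta>)" s] mult_nonneg_nonneg
        by (simp, linarith)
      then show ?thesis by (simp add: t_def axis_def)
    qed
    show "(+) (t q) ` ?A \<subseteq> ?W"
    proof (clarsimp simp: max_norm_le_iff near_resonance_def)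
      fix x :: "(real^'n)^'p" and k l assume "\<forall>i j. \<bar>x $ i $ j\<bar> \<le> R"
      then show "\<bar>t q $ k $ l + x $ k $ l\<bar> \<le> R + 1" using shift[of k l]
        by (metis abs_triangle_ineq add.commute add_mono order_trans)
    qed
  next
    fix q q' x y assume "x \<in> ?A" "y \<in> ?A" and eq: "t q + x = t q' + y"
    have "q $ k = q' $ k" for k
    proof -
      have "t q $ k + x $ k = t q' $ k + y $ k" using eq by (metis vector_add_component)
      then have "t q $ k - t q' $ k = y $ k - x $ k"
        by (simp add: algebra_simps)
      moreover have "t q $ k - t q' $ k = (real_of_int (q $ k - q' $ k) * s) *\<^sub>R axis i 1"
        by (simp add: t_def algebra_simps)
      ultimately have diff: "y $ k - x $ k = (real_of_int (q $ k - q' $ k) * s) *\<^sub>R axis i 1"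
        by simp
      have "(real_of_int (q $ k - q' $ k) * s) * real_vec m $ i =
          real_vec m \<bullet> y $ k - real_vec m \<bullet> x $ k"
        unfolding inner_diff_right[symmetric] diff by (simp add: inner_axis)
      moreover have "s > 0" using \<open>M \<ge> 1\<close> assms(2) by (simp add: s_def)
      ultimately have "\<bar>real_of_int (q $ k - q' $ k)\<bar> * (s * M) =
          \<bar>real_vec m \<bullet> y $ k - real_vec m \<bullet> x $ k\<bar>"
        unfolding i by (metis abs_mult abs_of_pos mult.assoc)
      also have "\<dots> \<le> 2 * \<eta>"
      proof -
        have "\<bar>real_vec m \<bullet> x $ k\<bar> \<le> \<eta>" "\<bar>real_vec m \<bullet> y $ k\<bar> \<le> \<eta>"
          using \<open>x \<in> ?A\<close> \<open>y \<in> ?A\<close> by (auto simp: near_resonance_def)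
        then show ?thesis by linarith
      qed
      also have "s * M = 3 * \<eta>" using \<open>M \<ge> 1\<close> by (simp add: s_def)
      finally have "\<bar>real_of_int (q $ k - q' $ k)\<bar> < 1" using assms(2) by simp
      then show ?thesis by linarith
    qed
    then show "q = q'" by (simp add: vec_eq_iff)
  qed
  then have "real Q ^ CARD('p) * measure lebesgue ?A \<le> measure lebesgue ?W" by (simp add: card_I)
  moreover have "(M / (6 * \<eta>)) ^ CARD('p) * measure lebesgue ?A \<le> real Q ^ CARD('p) * measure lebesgue ?A"
    using Q(2) \<open>M \<ge> 1\<close> assms(2) by (intro mult_right_mono power_mono) auto
  ultimately have "(M / (6 * \<eta>)) ^ CARD('p) * measure lebesgue ?A \<le> measure lebesgue ?W" by linarith
  then have "measure lebesgue ?A \<le> measure lebesgue ?W / (M / (6 * \<eta>)) ^ CARD('p)"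
    using \<open>M \<ge> 1\<close> assms(2) by (simp add: pos_le_divide_eq mult.commute)
  then show ?thesis
    by (simp add: M_def power_divide)
qed

lemma card_int_vec_infnorm_less:
  "finite {m::int^'n. infnorm (real_vec m) < 2 ^ Suc l}"
  "real (card {m::int^'n. infnorm (real_vec m) < 2 ^ Suc l}) \<le> (8 * 2 ^ l) ^ CARD('n)"
proof -
  let ?B = "{m::int^'n. \<forall>i. m $ i \<in> {- (2 ^ Suc l)..2 ^ Suc l}}"
  have sub: "{m::int^'n. infnorm (real_vec m) < 2 ^ Suc l} \<subseteq> ?B"
  proof (clarsimp simp only: infnorm_less_iff real_vec_nth mem_Collect_eq atLeastAtMost_iff)
    fix m :: "int^'n" and i assume "\<forall>i. \<bar>real_of_int (m $ i)\<bar> < 2 ^ Suc l"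
    then have "real_of_int \<bar>m $ i\<bar> < real_of_int (2 ^ Suc l)" by simp
    then have "\<bar>m $ i\<bar> < 2 ^ Suc l" by (simp only: of_int_less_iff)
    then show "- (2 ^ Suc l) \<le> m $ i \<and> m $ i \<le> 2 ^ Suc l" by linarith
  qed
  have fin: "finite ?B" by (rule card_vec_Collect) simp
  show "finite {m::int^'n. infnorm (real_vec m) < 2 ^ Suc l}" by (rule finite_subset[OF sub fin])
  have "real (card {m::int^'n. infnorm (real_vec m) < 2 ^ Suc l}) \<le> real (card ?B)"
    using card_mono[OF fin sub] by simp
  also have "card ?B = card {- (2 ^ Suc l)..2 ^ Suc l :: int} ^ CARD('n)"
    by (rule card_vec_Collect) simp
  also have "real \<dots> \<le> (8 * 2 ^ l) ^ CARD('n)"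
  proof -
    have "int (card {- (2 ^ Suc l)..2 ^ Suc l :: int}) = 4 * 2 ^ l + 1" by simp
    also have "\<dots> \<le> 8 * 2 ^ l" using one_le_power[of "2::int" l] by linarith
    finally have "real_of_int (int (card {- (2 ^ Suc l)..2 ^ Suc l :: int})) \<le> real_of_int (8 * 2 ^ l)"
      by (simp only: of_int_le_iff)
    then have "real (card {- (2 ^ Suc l)..2 ^ Suc l :: int}) \<le> 8 * 2 ^ l" by (simp only: of_int_of_nat_eq) simp
    then have "real (card {- (2 ^ Suc l)..2 ^ Suc l :: int}) ^ CARD('n) \<le> (8 * 2 ^ l) ^ CARD('n)"
      by (intro power_mono) auto
    then show ?thesis by (simp only: of_nat_power)
  qed
  finally show "real (card {m::int^'n. infnorm (real_vec m) < 2 ^ Suc l}) \<le> (8 * 2 ^ l) ^ CARD('n)" .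
qed

lemma dyadic_interval:
  fixes M :: real
  assumes "M \<ge> 1"
  obtains l :: nat where "2 ^ l \<le> M" "M < 2 ^ Suc l"
proof -
  define l where "l = nat \<lfloor>log 2 M\<rfloor>"
  have "log 2 M \<ge> 0" using assms by simp
  then have "real l \<le> log 2 M" "log 2 M < real (Suc l)" unfolding l_def by linarith+
  then have "2 powr real l \<le> M" "M < 2 powr real (Suc l)"
    using assms by (simp_all add: le_log_iff log_less_iff)
  then show ?thesis using that[of l] by (simp only: powr_realpow)
qed

text \<open>Convergence part of Borel--Cantelli, with the integer vectors grouped dyadically.\<close>

lemma negligible_not_forms_bounded_below:
  assumes "u \<ge> 0" and conv: "real CARD('n) < (u + 1) * real CARD('p)"
  shows "negligible {x::(real^'n::finite)^'p::finite. \<not> forms_bounded_below x u}"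
proof -
  \<comment> \<open>The dyadic shell at \<open>2 ^ l\<close> has about \<open>2 ^ (l * n)\<close>
    integer vectors, each contributing measure of order \<open>2 powr (- l * (u + 1) * p)\<close>.
    Hence successive shells decrease geometrically with ratio \<open>q = 2 powr a\<close>.\<close>
  define a where "a = real CARD('n) - (u + 1) * real CARD('p)"
  define q :: real where "q = 2 powr a"
  have "a < 0" using conv by (simp add: a_def)
  have q: "0 < q" "q < 1" using powr_less_mono[OF \<open>a < 0\<close>, of 2] by (simp_all add: q_def)
  have bounded_part: "negligible {x::(real^'n)^'p. max_norm x \<le> R \<and> \<not> forms_bounded_below x u}" for R
    unfolding negligible_outer_le
  proof (intro allI impI)
    fix \<epsilon> :: real assume "\<epsilon> > 0"
    define w where "w = measure lebesgue {x::(real^'n)^'p. max_norm x \<le> R + 1}"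
    have "w \<ge> 0" by (simp add: w_def)
    \<comment> \<open>With the constant \<open>c\<close> in the approximation bound, the geometric
      series adds up to at most \<open>K * c ^ p\<close>, which is at most \<open>K * c\<close>
      since \<open>c \<le> 1\<close>.\<close>
    define K where "K = w * 6 ^ CARD('p) * 8 ^ CARD('n) / (1 - q)"
    have "K \<ge> 0" using \<open>w \<ge> 0\<close> q by (simp add: K_def)
    \<comment> \<open>The bound \<open>1/3\<close> meets the hypothesis of
      \<open>measure_near_resonance_le\<close>, and \<open>K + 1\<close> avoids division by
      zero.\<close>
    define c where "c = min (1/3) (\<epsilon> / (K + 1))"
    have c: "0 < c" "c \<le> 1/3" "K * c \<le> \<epsilon>"
    proof -
      show "0 < c" using \<open>\<epsilon> > 0\<close> \<open>K \<ge> 0\<close> by (simp add: c_def)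
      show "c \<le> 1/3" unfolding c_def by (rule min.cobounded1)
      have "K * c \<le> (K + 1) * (\<epsilon> / (K + 1))"
        using \<open>K \<ge> 0\<close> \<open>0 < c\<close> by (intro mult_mono) (auto simp: c_def)
      then show "K * c \<le> \<epsilon>" using \<open>K \<ge> 0\<close> by simp
    qed
    define S where "S l = {m::int^'n. 2 ^ l \<le> infnorm (real_vec m) \<and> infnorm (real_vec m) < 2 ^ Suc l}" for l
    define \<eta> where "\<eta> l = c * (2 ^ l) powr (- u)" for l :: nat
    define E :: "nat \<Rightarrow> ((real^'n)^'p) set" where "E l = (\<Union>m\<in>S l. near_resonance R m (\<eta> l))" for l
    have \<eta>: "0 < \<eta> l" "\<eta> l \<le> 1/3" for l
    proof -
      show "0 < \<eta> l" using c(1) by (simp add: \<eta>_def)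
      have "(2 ^ l) powr (- u) \<le> (2 ^ l) powr (0::real)"
        using \<open>u \<ge> 0\<close> by (intro powr_mono) auto
      then have "c * (2 ^ l) powr (- u) \<le> c * 1" using c(1) by (intro mult_left_mono) auto
      then show "\<eta> l \<le> 1/3" using c(2) unfolding \<eta>_def by linarith
    qed
    have fin_S: "finite (S l)" for l
      by (rule finite_subset[OF _ card_int_vec_infnorm_less(1)[of l]]) (auto simp: S_def)
    have card_S: "real (card (S l)) \<le> (8 * 2 ^ l) ^ CARD('n)" for l
    proof -
      have "card (S l) \<le> card {m::int^'n. infnorm (real_vec m) < 2 ^ Suc l}"
        by (rule card_mono[OF card_int_vec_infnorm_less(1)]) (auto simp: S_def)
      then show ?thesis using card_int_vec_infnorm_less(2)[of l, where ?'n = 'n] by linarith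
    qed
    have E_meas: "E l \<in> lmeasurable" for l
      unfolding E_def using fin_S by (intro fmeasurable.finite_UN near_resonance_lmeasurable)
    have E_le: "measure lebesgue (E l) \<le> K * (1 - q) * c ^ CARD('p) * q ^ l" for l
    proof -
      have "measure lebesgue (E l) \<le> (\<Sum>m\<in>S l. measure lebesgue (near_resonance R m (\<eta> l) :: ((real^'n)^'p) set))"
        unfolding E_def using fin_S
        by (intro measure_UNION_le fmeasurableD near_resonance_lmeasurable)
      also have "\<dots> \<le> (\<Sum>m\<in>S l. w * (6 * \<eta> l / 2 ^ l) ^ CARD('p))"
      proof (rule sum_mono)
        fix m assume "m \<in> S l"
        then have m: "2 ^ l \<le> infnorm (real_vec m)" by (simp add: S_def)
        have "m \<noteq> 0"
        proof
          assume "m = 0"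
          then have "2 ^ l \<le> (0::real)" using m by (simp add: infnorm_0)
          then show False using zero_less_power[of "2::real" l] by linarith
        qed
        have "measure lebesgue (near_resonance R m (\<eta> l) :: ((real^'n)^'p) set)
            \<le> w * (6 * \<eta> l / infnorm (real_vec m)) ^ CARD('p)"
          unfolding w_def by (rule measure_near_resonance_le[OF \<open>m \<noteq> 0\<close> \<eta>])
        also have "\<dots> \<le> w * (6 * \<eta> l / 2 ^ l) ^ CARD('p)"
          using \<open>w \<ge> 0\<close> m \<eta>(1)[of l] infnorm_pos_le[of "real_vec m"]
          by (intro mult_left_mono power_mono divide_left_mono divide_nonneg_nonneg mult_pos_pos)
            (auto intro: less_le_trans[of 0 "2 ^ l"])
        finally show "measure lebesgue (near_resonance R m (\<eta> l) :: ((real^'n)^'p) set)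
            \<le> w * (6 * \<eta> l / 2 ^ l) ^ CARD('p)" .
      qed
      also have "\<dots> = real (card (S l)) * (w * (6 * \<eta> l / 2 ^ l) ^ CARD('p))" by simp
      also have "\<dots> \<le> (8 * 2 ^ l) ^ CARD('n) * (w * (6 * \<eta> l / 2 ^ l) ^ CARD('p))"
        using card_S \<open>w \<ge> 0\<close> \<eta>(1)[of l] by (intro mult_right_mono) auto
      also have "6 * \<eta> l / 2 ^ l = 6 * c * (2 ^ l) powr (- (u + 1))"
      proof -
        have "(2 ^ l) powr (- (u + 1)) = (2 ^ l) powr (- u) / (2 ^ l :: real)"
        proof -
          have "- (u + 1) = - u - 1" by simp
          then show ?thesis by (simp only: powr_diff) simp
        qed
        then show ?thesis by (simp add: \<eta>_def)
      qed
      also have "(6 * c * (2 ^ l) powr (- (u + 1))) ^ CARD('p) =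
          6 ^ CARD('p) * c ^ CARD('p) * (2 ^ l) powr (- ((u + 1) * real CARD('p)))"
      proof -
        have "((2 ^ l) powr (- (u + 1))) ^ CARD('p) = (2 ^ l :: real) powr (- ((u + 1) * real CARD('p)))"
          by (subst powr_realpow[symmetric]) (simp, simp only: powr_powr mult_minus_left)
        then show ?thesis by (simp only: power_mult_distrib)
      qed
      also have "(8 * 2 ^ l) ^ CARD('n) = 8 ^ CARD('n) * (2 ^ l :: real) powr (real CARD('n))"
        by (simp add: power_mult_distrib powr_realpow)
      finally have "measure lebesgue (E l) \<le> w * 6 ^ CARD('p) * 8 ^ CARD('n) * c ^ CARD('p) *
          ((2 ^ l) powr (real CARD('n)) * (2 ^ l) powr (- ((u + 1) * real CARD('p))))"
        by (simp only: mult_ac)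
      also have "(2 ^ l) powr (real CARD('n)) * (2 ^ l) powr (- ((u + 1) * real CARD('p))) = (2 ^ l :: real) powr a"
        unfolding powr_add[symmetric] a_def by simp
      also have "(2 ^ l :: real) powr a = q ^ l"
        unfolding q_def by (simp add: powr_powr mult.commute flip: powr_realpow)
      also have "w * 6 ^ CARD('p) * 8 ^ CARD('n) = K * (1 - q)"
        using q by (simp add: K_def)
      finally show ?thesis .
    qed
    have finite_bound: "measure lebesgue (\<Union>l\<in>I. E l) \<le> \<epsilon>" if "finite I" for I
    proof -
      have "measure lebesgue (\<Union>l\<in>I. E l) \<le> (\<Sum>l\<in>I. measure lebesgue (E l))"
        using that E_meas by (auto intro!: measure_UNION_le fmeasurableD)
      also have "\<dots> \<le> (\<Sum>l\<in>I. K * (1 - q) * c ^ CARD('p) * q ^ l)" by (intro sum_mono E_le)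
      also have "\<dots> = K * (1 - q) * c ^ CARD('p) * (\<Sum>l\<in>I. q ^ l)" by (simp add: sum_distrib_left)
      also have "\<dots> \<le> K * (1 - q) * c ^ CARD('p) * (1 / (1 - q))"
      proof (rule mult_left_mono)
        have "(\<Sum>l\<in>I. q ^ l) \<le> (\<Sum>l. q ^ l)"
          using that q by (intro sum_le_suminf summable_geometric) auto
        then show "(\<Sum>l\<in>I. q ^ l) \<le> 1 / (1 - q)" using q by (simp add: suminf_geometric)
        show "0 \<le> K * (1 - q) * c ^ CARD('p)" using \<open>K \<ge> 0\<close> q c by simp
      qed
      also have "\<dots> = K * c ^ CARD('p)" using q by simp
      also have "\<dots> \<le> K * c"
        using \<open>K \<ge> 0\<close> c power_decreasing[of 1 "CARD('p)" c] by (intro mult_left_mono) auto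
      also have "\<dots> \<le> \<epsilon>" by (rule c)
      finally show ?thesis .
    qed
    \<comment> \<open>Outside all \<open>E l\<close> the constant \<open>c\<close> works for every
      \<open>m\<close>: \<open>\<eta> l\<close> is taken at the lower end of the shell, where
      \<open>c * infnorm (real_vec m) powr (- u)\<close> is largest.\<close>
    have "{x::(real^'n)^'p. max_norm x \<le> R \<and> \<not> forms_bounded_below x u} \<subseteq> (\<Union>l. E l)"
    proof (rule subsetI, rule ccontr)
      fix x :: "(real^'n)^'p"
      assume x: "x \<in> {x. max_norm x \<le> R \<and> \<not> forms_bounded_below x u}" and notin: "x \<notin> (\<Union>l. E l)"
      have "\<exists>k. \<bar>real_vec m \<bullet> x $ k\<bar> > c * infnorm (real_vec m) powr (- u)" if nz: "m \<noteq> 0" for m :: "int^'n"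
      proof -
        obtain l where l: "2 ^ l \<le> infnorm (real_vec m)" "infnorm (real_vec m) < 2 ^ Suc l"
          using dyadic_interval[OF infnorm_real_vec_ge_1[OF nz]] .
        then have "x \<notin> near_resonance R m (\<eta> l)" using notin by (auto simp: E_def S_def)
        then obtain k where "\<bar>real_vec m \<bullet> x $ k\<bar> > \<eta> l"
          using x by (auto simp: near_resonance_def not_le)
        moreover have "c * infnorm (real_vec m) powr (- u) \<le> \<eta> l"
          unfolding \<eta>_def using c(1) l(1) \<open>u \<ge> 0\<close> by (intro mult_left_mono powr_mono2') auto
        ultimately show ?thesis by (meson le_less_trans)
      qed
      then have "forms_bounded_below x u" unfolding forms_bounded_below_def using c(1) by blast
      then show False using x by simp
    qed
    moreover have "(\<Union>l. E l) \<in> lmeasurable"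
      by (rule fmeasurable_UN_bound[OF _ E_meas finite_bound]) auto
    moreover have "measure lebesgue (\<Union>l. E l) \<le> \<epsilon>"
      by (rule measure_UN_bound[OF _ E_meas finite_bound]) auto
    ultimately show "\<exists>T. {x::(real^'n)^'p. max_norm x \<le> R \<and> \<not> forms_bounded_below x u} \<subseteq> T \<and>
        T \<in> lmeasurable \<and> measure lebesgue T \<le> \<epsilon>" by blast
  qed
  have "{x::(real^'n)^'p. \<not> forms_bounded_below x u} =
      (\<Union>R::nat. {x. max_norm x \<le> real R \<and> \<not> forms_bounded_below x u})"
    using real_arch_simple by auto
  also have "negligible \<dots>"
    using bounded_part by (intro negligible_countable_Union) auto
  finally show ?thesis .
qed

text \<open>By monotonicity in the exponent, the countable sequence \<open>1 / (k + 1)\<close>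
  replaces all positive \<epsilon>. Since \<open>(\<theta> + 1) * p = n\<close> is the boundary case
  of the convergence condition, each exponent above \<theta> satisfies it.\<close>

theorem AE_not_projectively_very_well_approximable:
  assumes "CARD('p::finite) < CARD('n::finite)"
  shows "AE x::(real^'n)^'p in lebesgue.
    linearly_independent_tuple x \<and> \<not> projectively_very_well_approximable x"
proof -
  define \<theta> where "\<theta> = (real CARD('n) - real CARD('p)) / real CARD('p)"
  have "\<theta> > 0" using assms by (simp add: \<theta>_def)
  define N where "N k = {x::(real^'n)^'p. \<not> forms_bounded_below x (\<theta> + 1 / real (Suc k))}" for k
  have "negligible (N k)" for k
    unfolding N_def
  proof (rule negligible_not_forms_bounded_below)
    show "\<theta> + 1 / real (Suc k) \<ge> 0" using \<open>\<theta> > 0\<close> by simp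
    have "(\<theta> + 1) * real CARD('p) = real CARD('n)" by (simp add: \<theta>_def field_simps)
    moreover have "(\<theta> + 1) * real CARD('p) < (\<theta> + 1 / real (Suc k) + 1) * real CARD('p)"
      by (intro mult_strict_right_mono) auto
    ultimately show "real CARD('n) < (\<theta> + 1 / real (Suc k) + 1) * real CARD('p)" by linarith
  qed
  then have "negligible (\<Union>k. N k)" by (intro negligible_countable_Union) auto
  then have neg: "negligible ((\<Union>k. N k) \<union> {x. \<not> linearly_independent_tuple x})"
    using negligible_dependent_tuples[OF assms] by (rule negligible_Un)
  have good: "\<not> projectively_very_well_approximable x" if "x \<notin> (\<Union>k. N k)" for x :: "(real^'n)^'p"
    unfolding not_projectively_very_well_approximable_iff
  proof (intro allI impI)
    fix \<epsilon> :: real assume "\<epsilon> > 0"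
    then obtain k where "1 / real (Suc k) < \<epsilon>" by (metis nat_approx_posE)
    moreover have "forms_bounded_below x (\<theta> + 1 / real (Suc k))" using that by (auto simp: N_def)
    ultimately show "forms_bounded_below x ((real CARD('n) - real CARD('p)) / real CARD('p) + \<epsilon>)"
      unfolding \<theta>_def by (elim forms_bounded_below_mono) simp
  qed
  show ?thesis
    by (rule AE_I'[OF neg[unfolded negligible_iff_null_sets]]) (use good in auto)
qed

theorem corollary1p4:
  assumes "2 \<le> CARD('n::finite)"
    and "1 \<le> CARD('p::finite)" and "CARD('p) \<le> CARD('n) - 1"
  shows "(\<forall>x::(real^'n)^'p.
            linearly_independent_tuple x \<and> \<not> projectively_very_well_approximable x \<longrightarrow>
            orbit_approximation_property x) \<and>
         (AE x::(real^'n)^'p in lebesgue. orbit_approximation_property x)"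
proof -
  have pn: "CARD('p) < CARD('n)" using assms by linarith
  have main: "orbit_approximation_property x"
    if "linearly_independent_tuple x \<and> \<not> projectively_very_well_approximable x" for x :: "(real^'n)^'p"
    using that orbit_approximation_property_if_forms_bounded_below[OF _ pn]
    by (simp add: not_projectively_very_well_approximable_iff)
  moreover have "AE x::(real^'n)^'p in lebesgue. orbit_approximation_property x"
    using AE_not_projectively_very_well_approximable[OF pn] by (rule AE_mp) (auto intro: main)
  ultimately show ?thesis by blast
qed

end
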